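(* Let $E_1,\dots,E_s$ be linear subspaces of $\mathbb R^d$, let $\mathscr E=\bigcup_{j=1}^sE_j$ and $S_{\mathscr E}=\mathscr E\cap\mathbb S^{d-1}$. Let $0<\varepsilon<1$ and $0<\eta<1/2$, and set $$a_{\mathscr E}=\log\left(\frac8\eta\sum_{j=1}^s9^{\dim E_j}\right).$$ Let $A,B\in O(d)$ and $I\subseteq\{1,\dots,d\}$ with $|I|=m$. Assume that $m\ge2025\,\varepsilon^{-2}a_{\mathscr E}$ and $$36\,\kappa_I(A)\,\Theta_B(S_{\mathscr E})\,m\,(a_{\mathscr E}+\log d)(a_{\mathscr E}+\log m)\le d.$$ Then, with probability at least $1-\eta$, the random linear map $\Phi=\sqrt{\frac dm}\,P_IAD_\xi P_\pi BD_{\xi'}:\mathbb R^d\to\mathbb R^m$ satisfies $$\bigl|\|\Phi x\|_2^2-\|x\|_2^2\bigr|\le\varepsilon\|x\|_2^2\qquad\text{for every }x\in\mathscr E.$$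
   Context: $O(d)$ is the group of real orthogonal $d\times d$ matrices, $\mathbb S^{d-1}$ the Euclidean unit sphere of $\mathbb R^d$, $[d]=\{1,\dots,d\}$. $P_I\in\mathbb R^{m\times d}$ is restriction to the coordinates in $I$. $\xi,\xi'$ are uniform on $\{-1,1\}^d$, $\pi$ is a uniform permutation in $S_d$, and $\xi,\xi',\pi$ are independent; $D_\xi=\operatorname{diag}(\xi_1,\dots,\xi_d)$, and $P_\pi$ is the permutation matrix with $(P_\pi x)_k=x_{\pi(k)}$. $\kappa_I(A)=\frac dm\max_{k\in[d]}\sum_{j\in I}A_{jk}^2$, and for $X\subseteq\mathbb S^{d-1}$, $\Theta_B(X)=d\sup_{x\in X,\,k\in[d]}\sum_{j=1}^dB_{kj}^2x_j^2$. *)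

theory Defs
  imports "HOL-Probability.Probability"
begin

text \<open>
  The space \<open>\<real>\<^sup>d\<close> is \<^typ>\<open>real ^ 'd\<close> with \<open>d = CARD('d)\<close>; the finite type \<open>'d\<close> plays the role of
  the index set \<open>{1, \<dots>, d}\<close>, and a matrix \<open>A :: real ^ 'd ^ 'd\<close> has entries \<open>A $ j $ k\<close> (row \<open>j\<close>, column \<open>k\<close>).
  Likewise \<open>\<real>\<^sup>m\<close> is \<^typ>\<open>real ^ 'm\<close>.
\<close>

text \<open>
  \<open>(coord_matrix f *v x) $ k = x $ f k\<close>. This covers both matrices of the construction:
  for a permutation \<open>f :: 'd \<Rightarrow> 'd\<close> it is the permutation matrix \<open>P\<^sub>f\<close>, and for an enumeration
  \<open>f :: 'm \<Rightarrow> 'd\<close> of a set \<open>I\<close> of \<open>m\<close> coordinates it is the restriction \<open>P\<^sub>I :: \<real>\<^sup>d \<rightarrow> \<real>\<^sup>m\<close>.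
\<close>
definition coord_matrix :: "('n::finite \<Rightarrow> 'd::finite) \<Rightarrow> real ^ 'd ^ 'n" where
  "coord_matrix f = (\<chi> k j. if j = f k then 1 else 0)"

definition diag_matrix :: "real ^ 'd::finite \<Rightarrow> real ^ 'd ^ 'd" where
  "diag_matrix v = (\<chi> i j. if i = j then v $ i else 0)"

definition sign_vectors :: "(real ^ 'd::finite) set" where
  "sign_vectors = {v. \<forall>i. v $ i \<in> {-1, 1}}"

text \<open>The joint law of the independent triple \<open>(\<xi>, \<xi>', \<pi>)\<close>.\<close>
definition sign_perm_pmf ::
    "((real ^ 'd::finite) \<times> (real ^ 'd) \<times> ('d \<Rightarrow> 'd)) pmf" where
  "sign_perm_pmf =
     pair_pmf (pmf_of_set sign_vectors)
       (pair_pmf (pmf_of_set sign_vectors) (pmf_of_set {p. p permutes UNIV}))"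

definition kappa :: "'d::finite set \<Rightarrow> real ^ 'd ^ 'd \<Rightarrow> real" where
  "kappa I A =
     real CARD('d) / real (card I) * Max (range (\<lambda>k. \<Sum>j\<in>I. (A $ j $ k)\<^sup>2))"

text \<open>
  Meant for \<open>X\<close> a subset of the unit sphere, where the supremum is over a bounded set of reals.
  For \<open>X = {}\<close> the value is unspecified.
\<close>
definition Theta :: "real ^ 'd ^ 'd \<Rightarrow> (real ^ 'd::finite) set \<Rightarrow> real" where
  "Theta B X =
     real CARD('d) * (SUP (x, k) \<in> X \<times> UNIV. \<Sum>j\<in>UNIV. (B $ k $ j)\<^sup>2 * (x $ j)\<^sup>2)"

text \<open>The map \<open>\<Phi>\<close>, with the enumeration \<open>e :: 'm \<Rightarrow> 'd\<close> of the coordinates in \<open>I\<close> as a parameter.\<close>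
definition Phi ::
    "('m::finite \<Rightarrow> 'd::finite) \<Rightarrow> real ^ 'd ^ 'd \<Rightarrow> real ^ 'd ^ 'd
      \<Rightarrow> real ^ 'd \<Rightarrow> real ^ 'd \<Rightarrow> ('d \<Rightarrow> 'd) \<Rightarrow> real ^ 'd ^ 'm" where
  "Phi e A B \<xi> \<xi>' \<pi> =
     sqrt (real CARD('d) / real CARD('m)) *\<^sub>R
       (coord_matrix e ** A ** diag_matrix \<xi> ** coord_matrix \<pi> ** B ** diag_matrix \<xi>')"

lemma coord_matrix_mult_vec: "(coord_matrix f *v x) $ k = x $ f k"
  by (simp add: coord_matrix_def matrix_vector_mult_def if_distrib if_distribR cong: if_cong)

lemma diag_matrix_mult_vec: "(diag_matrix v *v x) $ k = v $ k * x $ k"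
  by (simp add: diag_matrix_def matrix_vector_mult_def if_distrib if_distribR cong: if_cong)

text \<open>Needed for \<^const>\<open>pmf_of_set\<close> to be the uniform distribution.\<close>
lemma finite_sign_vectors: "finite (sign_vectors :: (real ^ 'd::finite) set)"
proof -
  have "(sign_vectors :: (real ^ 'd) set) \<subseteq> vec_lambda ` (UNIV \<rightarrow>\<^sub>E {-1, 1})"
  proof
    fix v :: "real ^ 'd" assume "v \<in> sign_vectors"
    then have "vec_nth v \<in> UNIV \<rightarrow>\<^sub>E {-1, 1}"
      by (auto simp: sign_vectors_def PiE_def Pi_def)
    then show "v \<in> vec_lambda ` (UNIV \<rightarrow>\<^sub>E {-1, 1})"
      by (metis image_eqI vec_nth_inverse)
  qed
  moreover have "finite (vec_lambda ` ((UNIV :: 'd set) \<rightarrow>\<^sub>E {-1, 1 :: real}))"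
    by (intro finite_imageI finite_PiE) auto
  ultimately show ?thesis by (rule finite_subset)
qed

lemma sign_vectors_nonempty: "(sign_vectors :: (real ^ 'd::finite) set) \<noteq> {}"
  using vec_component[of "1 :: real"] by (auto simp: sign_vectors_def intro!: exI[of _ "vec 1"])

lemma finite_permutes_UNIV: "finite {p. p permutes (UNIV :: 'd::finite set)}"
  by (rule finite_permutations) simp

lemma permutes_UNIV_nonempty: "{p. p permutes (UNIV :: 'd::finite set)} \<noteq> {}"
  using permutes_id by blast

end

theory Submission
  imports Defs
begin

text \<open>
  For a fixed unit vector \<open>x\<close>, put \<open>y = B D\<^sub>\<xi>\<^sub>' x\<close>, \<open>u k = y\<^sub>k\<^sup>2\<close>, and let \<open>w k\<close> be the \<open>k\<close>-th column of
  \<open>sqrt (d / m) P\<^sub>I A\<close>. Then \<open>\<Phi> x = R \<xi>\<close> with \<open>R R\<^sup>T = X = \<Sum>k. u (\<pi> k) w\<^sub>k w\<^sub>k\<^sup>T\<close>. The signs \<open>\<xi>'\<close> flatten \<open>y\<close>,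
  the permutation makes the trace of \<open>X\<close> close to \<open>1\<close> and its norm \<open>O(1 / m)\<close>, and the signs \<open>\<xi>\<close> then
  concentrate the quadratic form \<open>|R \<xi>|\<^sup>2\<close> around that trace. All of these bounds come from exchangeable pairs
  (flip one sign, or swap two values of \<open>\<pi>\<close>). For the scalar quantities an exchangeable pair gives a differential
  inequality for the moment generating function; for the norm of \<open>X\<close> it gives a recursion for
  the trace moments \<open>E tr X\<^sup>n\<close>, of which \<open>n \<approx> a + ln m\<close> is used. A union bound over \<open>1 / 4\<close>-nets of the unit
  spheres of the subspaces, of cardinality at most \<open>9\<^sup>d\<^sup>i\<^sup>m\<close>, finishes the proof.
\<close>

subsection \<open>Tails from a differential inequality\<close>

text \<open>Sampling by a permutation is sampling without replacement: the summands of X are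
  dependent, and X need not commute with its swapped version. Every estimate closes because the
  squared increments of an exchangeable pair, summed over all flips or swaps, are at most a constant
  plus a multiple of the quantity itself. For X this is done inside traces of powers: powers of a
  Gram matrix are Gram matrices again, so all positivity comes without eigenvalues. The mean of X is
  1 / m times the identity. Passing from the norm to the trace costs a factor m, whence
  \<open>ln m\<close> in the hypothesis; flattening is a union bound over d coordinates, whence
  \<open>ln d\<close>. The constant 36 is 2 * 18, with 2 from the tail of one coordinate of y and 18
  from the moment recursion. One vector fails with probability at most (2 + 3 + 2) * exp (- a), for
  \<xi>', \<pi> and \<xi> in turn, which the 8 / \<eta> inside a covers. On the net the error is
  \<epsilon> / 2, split evenly between the trace of X and the quadratic form in \<xi>.\<close>

lemma exp_trapezoid:
  fixes x y :: real
  shows "(x - y) * (exp x - exp y) \<le> (x - y)\<^sup>2 * (exp x + exp y) / 2"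
proof -
  \<comment> \<open>Convexity of \<open>exp\<close>: its mean over an interval is at most the mean
    of its endpoint values. This trades a difference of exponentials for a sum, which
    exchangeability treats symmetrically. With \<open>s\<close> the gap between the two points only
    one variable remains.\<close>
  have pos: "exp s - 1 \<le> s * (exp s + 1) / 2" if "0 \<le> s" for s :: real
  proof -
    have "0 * (exp 0 + 1) / 2 - (exp 0 - 1) \<le> s * (exp s + 1) / 2 - (exp s - 1)"
    proof (rule DERIV_nonneg_imp_nondecreasing [OF that])
      fix t :: real
      assume "0 \<le> t" "t \<le> s"
      have "1 - t \<le> exp (- t)"
        using exp_ge_add_one_self[of "- t"] by simp
      then have "(1 - t) * exp t \<le> 1"
        by (simp add: exp_minus field_simps)
      then show "\<exists>d. ((\<lambda>t. t * (exp t + 1) / 2 - (exp t - 1)) has_real_derivative d) (at t) \<and> 0 \<le> d"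
        by (intro exI[of _ "(1 - (1 - t) * exp t) / 2"])
          (auto intro!: derivative_eq_intros simp: field_simps)
    qed
    then show ?thesis by simp
  qed
  have ordered: "(x - y) * (exp x - exp y) \<le> (x - y)\<^sup>2 * (exp x + exp y) / 2" if "y \<le> x" for x y :: real
  proof -
    have "exp y * (exp (x - y) - 1) \<le> exp y * ((x - y) * (exp (x - y) + 1) / 2)"
      using pos[of "x - y"] that by (intro mult_left_mono) auto
    also have "exp y * (exp (x - y) - 1) = exp x - exp y"
      by (simp add: exp_diff right_diff_distrib)
    also have "exp y * ((x - y) * (exp (x - y) + 1) / 2) = (x - y) * (exp x + exp y) / 2"
      by (simp add: exp_diff distrib_left distrib_right)
    finally have "exp x - exp y \<le> (x - y) * (exp x + exp y) / 2" .
    then have "(x - y) * (exp x - exp y) \<le> (x - y) * ((x - y) * (exp x + exp y) / 2)"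
      using that by (intro mult_left_mono) auto
    then show ?thesis by (simp add: power2_eq_square algebra_simps)
  qed
  show ?thesis
  proof (cases "y \<le> x")
    case False
    then show ?thesis
      using ordered[of x y] by (simp add: power2_commute[of x y] algebra_simps)
  qed (rule ordered)
qed

text \<open>Gronwall for the moment generating function \<open>h\<close>: the hypothesis says (1 -
  \<alpha> t) h' \<le> \<beta> t h, hence (ln h)' \<le> \<beta> t / \<gamma> when \<gamma> is a
  lower bound of 1 - \<alpha> t on the whole interval. Since \<alpha> may have either sign, this is
  asked at both ends, as \<gamma> \<le> 1 and \<gamma> \<le> 1 - \<alpha> \<theta>.\<close>

lemma mgf_bound:
  fixes f :: "'a \<Rightarrow> real"
  assumes fin: "finite \<Omega>" and "0 \<le> \<theta>" "0 < \<gamma>" "0 \<le> \<beta>"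
    and \<gamma>: "\<gamma> \<le> 1" "\<gamma> \<le> 1 - \<alpha> * \<theta>"
    and ode: "\<And>t. 0 \<le> t \<Longrightarrow> t \<le> \<theta> \<Longrightarrow>
      (\<Sum>x\<in>\<Omega>. f x * exp (t * f x)) \<le> t * (\<Sum>x\<in>\<Omega>. (\<alpha> * f x + \<beta>) * exp (t * f x))"
  shows "(\<Sum>x\<in>\<Omega>. exp (\<theta> * f x)) \<le> real (card \<Omega>) * exp (\<beta> * \<theta>\<^sup>2 / (2 * \<gamma>))"
proof -
  define h where "h t = (\<Sum>x\<in>\<Omega>. exp (t * f x))" for t
  define h' where "h' t = (\<Sum>x\<in>\<Omega>. f x * exp (t * f x))" for t
  have dh: "(h has_real_derivative h' t) (at t)" for t
    unfolding h_def[abs_def] h'_def by (auto intro!: derivative_eq_intros sum.cong)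
  have h0: "0 \<le> h t" for t by (auto simp: h_def intro: sum_nonneg)
  have le: "h' t \<le> (\<beta> / \<gamma>) * t * h t" if t: "0 \<le> t" "t \<le> \<theta>" for t
  proof (cases "0 \<le> h' t")
    case True
    have "\<gamma> \<le> 1 - \<alpha> * t"
    proof (cases "0 \<le> \<alpha>")
      case True
      then have "\<alpha> * t \<le> \<alpha> * \<theta>" using t by (intro mult_left_mono) auto
      with \<gamma> show ?thesis by simp
    next
      case False
      then have "\<alpha> * t \<le> 0" using t by (simp add: mult_nonpos_nonneg)
      with \<gamma> show ?thesis by simp
    qed
    then have "\<gamma> * h' t \<le> (1 - \<alpha> * t) * h' t" using True by (intro mult_right_mono)
    also have "\<dots> \<le> t * \<beta> * h t"
      using ode[OF t] unfolding h_def h'_def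
      by (simp add: algebra_simps sum.distrib sum_subtractf sum_distrib_left)
    finally show ?thesis using \<open>0 < \<gamma>\<close> by (simp add: field_simps)
  next
    case False
    moreover have "0 \<le> (\<beta> / \<gamma>) * t * h t" using assms t h0 by simp
    ultimately show ?thesis by simp
  qed
  define g where "g t = h t * exp (- (\<beta> * t\<^sup>2 / (2 * \<gamma>)))" for t
  have "g \<theta> \<le> g 0"
  proof (rule DERIV_nonpos_imp_nonincreasing [OF \<open>0 \<le> \<theta>\<close>])
    fix t assume t: "0 \<le> t" "t \<le> \<theta>"
    show "\<exists>y. DERIV g t :> y \<and> y \<le> 0"
    proof (intro exI conjI)
      show "DERIV g t :> (h' t - (\<beta> / \<gamma>) * t * h t) * exp (- (\<beta> * t\<^sup>2 / (2 * \<gamma>)))"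
        unfolding g_def[abs_def] using \<open>0 < \<gamma>\<close>
        by (auto intro!: derivative_eq_intros dh simp: field_simps)
      show "(h' t - (\<beta> / \<gamma>) * t * h t) * exp (- (\<beta> * t\<^sup>2 / (2 * \<gamma>))) \<le> 0"
        using le[OF t] by (simp add: mult_nonpos_nonneg)
    qed
  qed
  then show ?thesis
    by (simp add: g_def h_def exp_minus field_simps)
qed

text \<open>Markov's inequality at exponent \<theta>. Leaving \<theta> and the rate \<open>s\<close>
  free reduces each later tail bound to one scalar inequality. The laws are uniform on finite sets,
  so probabilities appear as cardinalities.\<close>

lemma mgf_tail:
  fixes f :: "'a \<Rightarrow> real"
  assumes fin: "finite \<Omega>" and "0 \<le> \<theta>" "0 < \<gamma>" "0 \<le> \<beta>"
    and "\<gamma> \<le> 1" "\<gamma> \<le> 1 - \<alpha> * \<theta>"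
    and "\<And>t. 0 \<le> t \<Longrightarrow> t \<le> \<theta> \<Longrightarrow>
      (\<Sum>x\<in>\<Omega>. f x * exp (t * f x)) \<le> t * (\<Sum>x\<in>\<Omega>. (\<alpha> * f x + \<beta>) * exp (t * f x))"
    and s: "\<beta> * \<theta>\<^sup>2 / (2 * \<gamma>) + s \<le> \<theta> * r"
  shows "real (card {x\<in>\<Omega>. r \<le> f x}) \<le> real (card \<Omega>) * exp (- s)"
proof -
  have "real (card {x\<in>\<Omega>. r \<le> f x}) * exp (\<theta> * r) = (\<Sum>x\<in>{x\<in>\<Omega>. r \<le> f x}. exp (\<theta> * r))"
    by simp
  also have "\<dots> \<le> (\<Sum>x\<in>{x\<in>\<Omega>. r \<le> f x}. exp (\<theta> * f x))"
    using assms by (intro sum_mono) (auto intro: mult_left_mono)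
  also have "\<dots> \<le> (\<Sum>x\<in>\<Omega>. exp (\<theta> * f x))"
    using fin by (intro sum_mono2) auto
  also have "\<dots> \<le> real (card \<Omega>) * exp (\<beta> * \<theta>\<^sup>2 / (2 * \<gamma>))"
    by (rule mgf_bound[of _ _ _ _ \<alpha>]) (use assms in auto)
  also have "\<dots> \<le> real (card \<Omega>) * exp (\<theta> * r - s)"
    using s by (intro mult_left_mono) auto
  finally show ?thesis by (simp add: exp_diff exp_minus field_simps)
qed

subsection \<open>Random signs\<close>

definition flip :: "'d \<Rightarrow> real ^ 'd::finite \<Rightarrow> real ^ 'd" where
  "flip i \<xi> = (\<chi> j. if j = i then - \<xi> $ j else \<xi> $ j)"

lemma flip_flip [simp]: "flip i (flip i \<xi>) = \<xi>"
  by (simp add: flip_def vec_eq_iff)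

lemma flip_in_sign_vectors [simp]: "flip i \<xi> \<in> sign_vectors \<longleftrightarrow> \<xi> \<in> sign_vectors"
  unfolding sign_vectors_def flip_def
  by (auto split: if_splits)

lemma sum_sign_vectors_flip:
  "(\<Sum>\<xi>\<in>sign_vectors. g (flip i \<xi>)) = (\<Sum>\<xi>\<in>sign_vectors. g \<xi>)"
  by (rule sum.reindex_bij_witness[of _ "flip i" "flip i"]) auto

lemma sign_vectors_square: "\<xi> \<in> sign_vectors \<Longrightarrow> (\<xi> $ i)\<^sup>2 = 1"
  by (auto simp: sign_vectors_def power2_eq_1_iff)

text \<open>Flipping preserves the uniform law and negates \<open>D\<close>, so the left sum is half
  the sum of D (exp (t F) - exp (t F')), where F' is F after the flip. As F - F' = c D,
  \<open>exp_trapezoid\<close> applies, and the invariance of D^2 merges the two exponentials. The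
  case t c = 0 is separate because the argument divides by t c.\<close>

lemma flip_exchange:
  fixes D F :: "real ^ 'd::finite \<Rightarrow> real"
  assumes D: "\<And>\<xi>. D (flip i \<xi>) = - D \<xi>"
    and F: "\<And>\<xi>. F (flip i \<xi>) = F \<xi> - c * D \<xi>" and "0 \<le> c" "0 \<le> t"
  shows "(\<Sum>\<xi>\<in>sign_vectors. D \<xi> * exp (t * F \<xi>))
    \<le> t * c / 2 * (\<Sum>\<xi>\<in>sign_vectors. (D \<xi>)\<^sup>2 * exp (t * F \<xi>))"
proof -
  let ?S = "sign_vectors :: (real ^ 'd) set"
  have eq1: "(\<Sum>\<xi>\<in>?S. D \<xi> * exp (t * F \<xi>)) = - (\<Sum>\<xi>\<in>?S. D \<xi> * exp (t * F (flip i \<xi>)))"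
    using sum_sign_vectors_flip[of "\<lambda>\<xi>. D \<xi> * exp (t * F \<xi>)" i] by (simp add: D sum_negf)
  have eq2: "(\<Sum>\<xi>\<in>?S. (D \<xi>)\<^sup>2 * exp (t * F \<xi>)) = (\<Sum>\<xi>\<in>?S. (D \<xi>)\<^sup>2 * exp (t * F (flip i \<xi>)))"
    using sum_sign_vectors_flip[of "\<lambda>\<xi>. (D \<xi>)\<^sup>2 * exp (t * F \<xi>)" i] by (simp add: D)
  have pt: "D \<xi> * (exp (t * F \<xi>) - exp (t * F (flip i \<xi>)))
      \<le> t * c / 2 * (D \<xi>)\<^sup>2 * (exp (t * F \<xi>) + exp (t * F (flip i \<xi>)))" for \<xi>
  proof (cases "t * c = 0")
    case True
    then show ?thesis by (auto simp: F)
  next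
    case False
    with assms have pos: "0 < t * c" by (simp add: less_le)
    have "(t * c) * (D \<xi> * (exp (t * F \<xi>) - exp (t * F (flip i \<xi>))))
        = (t * F \<xi> - t * F (flip i \<xi>)) * (exp (t * F \<xi>) - exp (t * F (flip i \<xi>)))"
      by (simp add: F algebra_simps)
    also have "\<dots> \<le> (t * F \<xi> - t * F (flip i \<xi>))\<^sup>2 * (exp (t * F \<xi>) + exp (t * F (flip i \<xi>))) / 2"
      by (rule exp_trapezoid)
    also have "(t * F \<xi> - t * F (flip i \<xi>)) = (t * c) * D \<xi>"
      by (simp add: F algebra_simps)
    also have "((t * c) * D \<xi>)\<^sup>2 * (exp (t * F \<xi>) + exp (t * F (flip i \<xi>))) / 2
        = (t * c) * (t * c / 2 * (D \<xi>)\<^sup>2 * (exp (t * F \<xi>) + exp (t * F (flip i \<xi>))))"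
      by (simp add: power2_eq_square)
    finally show ?thesis using pos by (simp only: mult_le_cancel_left_pos)
  qed
  have "2 * (\<Sum>\<xi>\<in>?S. D \<xi> * exp (t * F \<xi>))
      = (\<Sum>\<xi>\<in>?S. D \<xi> * (exp (t * F \<xi>) - exp (t * F (flip i \<xi>))))"
    using eq1 by (simp add: right_diff_distrib sum_subtractf)
  also have "\<dots> \<le> (\<Sum>\<xi>\<in>?S. t * c / 2 * (D \<xi>)\<^sup>2 * (exp (t * F \<xi>) + exp (t * F (flip i \<xi>))))"
    by (intro sum_mono pt)
  also have "\<dots> = 2 * (t * c / 2 * (\<Sum>\<xi>\<in>?S. (D \<xi>)\<^sup>2 * exp (t * F \<xi>)))"
    by (simp add: distrib_left sum.distrib mult.assoc eq2[symmetric] flip: sum_distrib_left sum_divide_distrib)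
  finally show ?thesis by simp
qed

text \<open>Hoeffding's inequality: flipping sign i changes the sum by twice its i-th term, so the
  differential inequality holds with \<alpha> = 0 for every t \<ge> 0, and \<theta> = r / v is the
  optimal exponent.\<close>

lemma rademacher_sum_tail:
  fixes c :: "'d::finite \<Rightarrow> real"
  assumes v: "(\<Sum>i\<in>UNIV. (c i)\<^sup>2) \<le> v" and "0 < v" "0 \<le> r"
  shows "real (card {\<xi>\<in>sign_vectors. r \<le> (\<Sum>i\<in>UNIV. c i * \<xi> $ i)})
    \<le> real (card (sign_vectors :: (real ^ 'd) set)) * exp (- (r\<^sup>2 / (2 * v)))"
proof (rule mgf_tail[where \<theta> = "r / v" and \<alpha> = 0 and \<beta> = v and \<gamma> = 1])
  fix t :: real assume t: "0 \<le> t"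
  define F where "F \<xi> = (\<Sum>i\<in>UNIV. c i * \<xi> $ i)" for \<xi> :: "real ^ 'd"
  let ?S = "sign_vectors :: (real ^ 'd) set"
  have "(\<Sum>\<xi>\<in>?S. F \<xi> * exp (t * F \<xi>)) = (\<Sum>i\<in>UNIV. \<Sum>\<xi>\<in>?S. (c i * \<xi> $ i) * exp (t * F \<xi>))"
    by (subst sum.swap) (simp add: F_def sum_distrib_right)
  also have "\<dots> \<le> (\<Sum>i\<in>UNIV. t * 2 / 2 * (\<Sum>\<xi>\<in>?S. (c i * \<xi> $ i)\<^sup>2 * exp (t * F \<xi>)))"
  proof (intro sum_mono flip_exchange)
    fix i and \<xi> :: "real ^ 'd"
    show "c i * flip i \<xi> $ i = - (c i * \<xi> $ i)" by (simp add: flip_def)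
    have "F \<xi> - F (flip i \<xi>) = (\<Sum>j\<in>UNIV. if j = i then 2 * (c i * \<xi> $ i) else 0)"
      unfolding F_def sum_subtractf[symmetric] by (intro sum.cong) (auto simp: flip_def)
    then show "F (flip i \<xi>) = F \<xi> - 2 * (c i * \<xi> $ i)" by simp
  qed (use t in auto)
  also have "\<dots> = t * (\<Sum>i\<in>UNIV. \<Sum>\<xi>\<in>?S. (c i)\<^sup>2 * exp (t * F \<xi>))"
    by (simp add: sum_distrib_left power_mult_distrib sign_vectors_square)
  also have "\<dots> = t * (\<Sum>\<xi>\<in>?S. (\<Sum>i\<in>UNIV. (c i)\<^sup>2) * exp (t * F \<xi>))"
    by (subst sum.swap) (simp add: sum_distrib_right)
  also have "\<dots> \<le> t * (\<Sum>\<xi>\<in>?S. (0 * F \<xi> + v) * exp (t * F \<xi>))"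
    using v t by (intro mult_left_mono sum_mono mult_right_mono) auto
  finally show "(\<Sum>\<xi>\<in>?S. (\<Sum>i\<in>UNIV. c i * \<xi> $ i) * exp (t * (\<Sum>i\<in>UNIV. c i * \<xi> $ i)))
    \<le> t * (\<Sum>\<xi>\<in>?S. (0 * (\<Sum>i\<in>UNIV. c i * \<xi> $ i) + v) * exp (t * (\<Sum>i\<in>UNIV. c i * \<xi> $ i)))"
    by (simp add: F_def)
qed (use assms finite_sign_vectors in \<open>auto simp: power2_eq_square field_simps\<close>)

text \<open>Changing the sign of \<open>\<xi>\<^sub>i\<close> changes \<open>F = \<xi> \<bullet> H \<xi>\<close> by \<open>4 \<xi>\<^sub>i (H \<xi>)\<^sub>i\<close>.\<close>
lemma rademacher_chaos_mgf:
  fixes H :: "real ^ 'd ^ 'd::finite"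
  assumes sym: "transpose H = H" and diag: "\<And>i. H $ i $ i = 0" and "0 \<le> t"
  shows "(\<Sum>\<xi>\<in>sign_vectors. (\<xi> \<bullet> (H *v \<xi>)) * exp (t * (\<xi> \<bullet> (H *v \<xi>))))
    \<le> 2 * t * (\<Sum>\<xi>\<in>sign_vectors. (norm (H *v \<xi>))\<^sup>2 * exp (t * (\<xi> \<bullet> (H *v \<xi>))))"
proof -
  define F where "F \<xi> = \<xi> \<bullet> (H *v \<xi>)" for \<xi> :: "real ^ 'd"
  let ?S = "sign_vectors :: (real ^ 'd) set"
  have Fdiff: "F (flip i \<xi>) = F \<xi> - 4 * (\<xi> $ i * (H *v \<xi>) $ i)" for i \<xi>
  proof -
    define w where "w = (- 2 * \<xi> $ i) *\<^sub>R axis i (1::real)"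
    have fl: "flip i \<xi> = \<xi> + w"
      by (auto simp: flip_def w_def vec_eq_iff axis_def)
    \<comment> \<open>The zero diagonal kills the part quadratic in the change \<open>w\<close>, so
      the increment is exactly a multiple of the antisymmetric term that
      \<open>flip_exchange\<close> asks for.\<close>
    have "w \<bullet> (H *v w) = 0"
      unfolding w_def matrix_vector_mult_scaleR inner_scaleR_left inner_scaleR_right inner_axis'
      by (simp add: matrix_vector_mult_basis column_def diag)
    moreover have "\<xi> \<bullet> (H *v w) = w \<bullet> (H *v \<xi>)"
      using dot_lmul_matrix[of \<xi> H w] sym by (metis inner_commute transpose_matrix_vector)
    ultimately have "F (flip i \<xi>) = F \<xi> + 2 * (w \<bullet> (H *v \<xi>))"
      unfolding F_def fl by (simp add: matrix_vector_right_distrib inner_add_left inner_add_right)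
    then show ?thesis by (simp add: w_def inner_axis')
  qed
  have D: "flip i \<xi> $ i * (H *v flip i \<xi>) $ i = - (\<xi> $ i * (H *v \<xi>) $ i)" for i \<xi>
  proof -
    have "(H *v flip i \<xi>) $ i = (H *v \<xi>) $ i"
      unfolding matrix_vector_mult_def using diag by (auto simp: flip_def intro!: sum.cong)
    then show ?thesis by (simp add: flip_def)
  qed
  have "(\<Sum>\<xi>\<in>?S. F \<xi> * exp (t * F \<xi>)) = (\<Sum>i\<in>UNIV. \<Sum>\<xi>\<in>?S. (\<xi> $ i * (H *v \<xi>) $ i) * exp (t * F \<xi>))"
    by (subst sum.swap) (simp add: F_def inner_vec_def sum_distrib_right)
  also have "\<dots> \<le> (\<Sum>i\<in>UNIV. t * 4 / 2 * (\<Sum>\<xi>\<in>?S. (\<xi> $ i * (H *v \<xi>) $ i)\<^sup>2 * exp (t * F \<xi>)))"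
  proof (intro sum_mono)
    fix i
    show "(\<Sum>\<xi>\<in>?S. (\<xi> $ i * (H *v \<xi>) $ i) * exp (t * F \<xi>))
      \<le> t * 4 / 2 * (\<Sum>\<xi>\<in>?S. (\<xi> $ i * (H *v \<xi>) $ i)\<^sup>2 * exp (t * F \<xi>))"
      by (rule flip_exchange[where i = i]) (use \<open>0 \<le> t\<close> D Fdiff in auto)
  qed
  also have "\<dots> = 2 * t * (\<Sum>i\<in>UNIV. \<Sum>\<xi>\<in>?S. ((H *v \<xi>) $ i)\<^sup>2 * exp (t * F \<xi>))"
    by (simp add: sum_distrib_left power_mult_distrib sign_vectors_square)
  also have "\<dots> = 2 * t * (\<Sum>\<xi>\<in>?S. (norm (H *v \<xi>))\<^sup>2 * exp (t * F \<xi>))"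
    unfolding dot_square_norm[symmetric] inner_vec_def
    by (subst sum.swap) (simp add: sum_distrib_right power2_eq_square)
  finally show ?thesis by (simp add: F_def)
qed

text \<open>A Hanson-Wright bound. On signs the diagonal of the Gram matrix \<open>G\<close>
  contributes the constant \<tau>, so the deviation is the quadratic form of the zero-diagonal
  matrix \<open>H\<close>. The bound \<open>L\<close> controls G \<xi> by R \<xi>, which gives 2 |H
  \<xi>|^2 \<le> 4 L F + 4 (L + M) \<tau> with F the deviation itself: exactly the shape required by
  \<open>mgf_tail\<close>.\<close>

lemma rademacher_quadratic_tail:
  fixes R :: "real ^ 'd ^ 'm::finite"
  assumes L: "\<And>v. (norm (transpose R *v v))\<^sup>2 \<le> L * (norm v)\<^sup>2"
    and M: "\<And>i. (norm (column i R))\<^sup>2 \<le> M"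
    and \<tau>: "(\<Sum>i\<in>UNIV. (norm (column i R))\<^sup>2) = \<tau>"
    and "0 \<le> L" and \<theta>: "0 \<le> \<theta>" "4 * L * \<theta> < 1"
    and s: "4 * (L + M) * \<tau> * \<theta>\<^sup>2 / (2 * (1 - 4 * L * \<theta>)) + s \<le> \<theta> * r"
  shows "real (card {\<xi>\<in>sign_vectors. r \<le> \<bar>(norm (R *v \<xi>))\<^sup>2 - \<tau>\<bar>})
    \<le> 2 * real (card (sign_vectors :: (real ^ 'd) set)) * exp (- s)"
proof -
  let ?S = "sign_vectors :: (real ^ 'd) set"
  define G where "G = transpose R ** R"
  define g where "g i = (norm (column i R))\<^sup>2" for i
  define H where "H = (\<chi> i j. if i = j then 0 else G $ i $ j)"
  have Gii: "G $ i $ i = g i" for i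
    by (simp add: G_def g_def matrix_matrix_mult_def transpose_def column_def power2_norm_eq_inner inner_vec_def)
  have Gsym: "transpose G = G" by (simp add: G_def matrix_transpose_mul)
  have Hsym: "transpose H = H"
  proof -
    have "transpose G $ i $ j = G $ j $ i" for i j by (simp add: transpose_def)
    then have "G $ i $ j = G $ j $ i" for i j by (simp only: Gsym)
    then show ?thesis by (simp add: H_def transpose_def vec_eq_iff)
  qed
  have Hdiag: "H $ i $ i = 0" for i by (simp add: H_def)
  have Hmult: "H *v \<xi> = G *v \<xi> - (\<chi> i. g i * \<xi> $ i)" for \<xi>
  proof -
    have "(\<Sum>j\<in>UNIV. H $ i $ j * \<xi> $ j) + (\<Sum>j\<in>UNIV. if j = i then g i * \<xi> $ i else 0)
       = (\<Sum>j\<in>UNIV. G $ i $ j * \<xi> $ j)" for i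
      unfolding sum.distrib[symmetric] by (intro sum.cong) (auto simp: H_def Gii)
    then show ?thesis by (simp add: vec_eq_iff matrix_vector_mult_def eq_diff_eq)
  qed
  have Gmult: "G *v \<xi> = transpose R *v (R *v \<xi>)" for \<xi>
    unfolding G_def by (simp add: matrix_vector_mul_assoc del: transpose_matrix_vector)
  have \<tau>0: "0 \<le> \<tau>" unfolding \<tau>[symmetric] by (intro sum_nonneg) auto
  have M0: "0 \<le> M" using M[of undefined] by (rule order_trans[rotated]) simp
  have F: "\<xi> \<bullet> (H *v \<xi>) = (norm (R *v \<xi>))\<^sup>2 - \<tau>" if "\<xi> \<in> ?S" for \<xi>
  proof -
    have "\<xi> \<bullet> (G *v \<xi>) = (norm (R *v \<xi>))\<^sup>2"
      unfolding Gmult power2_norm_eq_inner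
      using dot_lmul_matrix[of \<xi> "transpose R" "R *v \<xi>"] by simp
    moreover have "\<xi> \<bullet> (\<chi> i. g i * \<xi> $ i) = \<tau>"
    proof -
      have "\<xi> \<bullet> (\<chi> i. g i * \<xi> $ i) = (\<Sum>i\<in>UNIV. g i * (\<xi> $ i)\<^sup>2)"
        by (simp add: inner_vec_def power2_eq_square algebra_simps)
      then show ?thesis
        using sign_vectors_square[OF that] by (simp add: \<tau>[symmetric] g_def)
    qed
    ultimately show ?thesis by (simp add: Hmult inner_diff_right)
  qed
  have HH: "2 * (norm (H *v \<xi>))\<^sup>2 \<le> 4 * L * ((norm (R *v \<xi>))\<^sup>2 - \<tau>) + 4 * (L + M) * \<tau>" if "\<xi> \<in> ?S" for \<xi>
  proof -
    let ?D = "(\<chi> i. g i * \<xi> $ i)"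
    have "(norm (H *v \<xi>))\<^sup>2 + (norm (G *v \<xi> + ?D))\<^sup>2 = 2 * (norm (G *v \<xi>))\<^sup>2 + 2 * (norm ?D)\<^sup>2"
      by (simp add: Hmult power2_norm_eq_inner inner_diff_left inner_diff_right inner_add_left inner_add_right inner_commute)
    then have "(norm (H *v \<xi>))\<^sup>2 \<le> 2 * (norm (G *v \<xi>))\<^sup>2 + 2 * (norm ?D)\<^sup>2"
      using zero_le_power2[of "norm (G *v \<xi> + ?D)"] by linarith
    moreover have "(norm (G *v \<xi>))\<^sup>2 \<le> L * (norm (R *v \<xi>))\<^sup>2"
      unfolding Gmult by (rule L)
    moreover have "(norm ?D)\<^sup>2 \<le> M * \<tau>"
    proof -
      have "(norm ?D)\<^sup>2 = (\<Sum>i\<in>UNIV. g i * g i * (\<xi> $ i)\<^sup>2)"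
        unfolding power2_norm_eq_inner by (simp add: inner_vec_def power2_eq_square algebra_simps)
      also have "\<dots> = (\<Sum>i\<in>UNIV. g i * g i)" using sign_vectors_square[OF that] by simp
      also have "\<dots> \<le> (\<Sum>i\<in>UNIV. M * g i)"
        using M by (intro sum_mono mult_right_mono) (auto simp: g_def)
      also have "\<dots> = M * \<tau>" by (simp add: \<tau>[symmetric] g_def sum_distrib_left)
      finally show ?thesis .
    qed
    ultimately show ?thesis by (simp add: algebra_simps)
  qed
  \<comment> \<open>Both tails at once: passing from \<open>H\<close> to \<open>- H\<close> only
    changes the sign of \<alpha>, and \<gamma> = 1 - 4 L \<theta> is admissible for both
    signs.\<close>
  have tail: "real (card {\<xi>\<in>?S. r \<le> f \<xi>}) \<le> real (card ?S) * exp (- s)"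
    if f: "\<And>\<xi>. \<xi> \<in> ?S \<Longrightarrow> f \<xi> = \<xi> \<bullet> (K *v \<xi>)" and K: "K = H \<and> \<sigma> = 1 \<or> K = - H \<and> \<sigma> = -1" for f K and \<sigma> :: real
  proof (rule mgf_tail[where \<theta> = \<theta> and \<gamma> = "1 - 4 * L * \<theta>" and \<alpha> = "\<sigma> * (4 * L)" and \<beta> = "4 * (L + M) * \<tau>"])
    fix t :: real assume t: "0 \<le> t"
    have nK: "norm (K *v \<xi>) = norm (H *v \<xi>)" for \<xi>
    proof -
      have "(- H) *v \<xi> = - (H *v \<xi>)" by (simp add: vec_eq_iff matrix_vector_mult_def sum_negf)
      then show ?thesis using K by auto
    qed
    have fK: "(norm (R *v \<xi>))\<^sup>2 - \<tau> = \<sigma> * f \<xi>" if "\<xi> \<in> ?S" for \<xi>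
    proof -
      have "(- H) *v \<xi> = - (H *v \<xi>)" by (simp add: vec_eq_iff matrix_vector_mult_def sum_negf)
      then show ?thesis using K f[OF that] F[OF that] by auto
    qed
    have "(\<Sum>\<xi>\<in>?S. f \<xi> * exp (t * f \<xi>)) = (\<Sum>\<xi>\<in>?S. (\<xi> \<bullet> (K *v \<xi>)) * exp (t * (\<xi> \<bullet> (K *v \<xi>))))"
      by (intro sum.cong) (auto simp: f)
    also have "\<dots> \<le> 2 * t * (\<Sum>\<xi>\<in>?S. (norm (K *v \<xi>))\<^sup>2 * exp (t * (\<xi> \<bullet> (K *v \<xi>))))"
    proof (rule rademacher_chaos_mgf[OF _ _ t])
      show "transpose K = K" using K Hsym by (auto simp: transpose_def vec_eq_iff)
      show "K $ i $ i = 0" for i using K Hdiag by auto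
    qed
    also have "\<dots> = t * (\<Sum>\<xi>\<in>?S. 2 * (norm (H *v \<xi>))\<^sup>2 * exp (t * f \<xi>))"
      by (simp add: sum_distrib_left nK f algebra_simps)
    also have "\<dots> \<le> t * (\<Sum>\<xi>\<in>?S. (\<sigma> * (4 * L) * f \<xi> + 4 * (L + M) * \<tau>) * exp (t * f \<xi>))"
    proof (intro mult_left_mono[OF _ t] sum_mono mult_right_mono)
      fix \<xi> assume "\<xi> \<in> ?S"
      from HH[OF this] fK[OF this]
      show "2 * (norm (H *v \<xi>))\<^sup>2 \<le> \<sigma> * (4 * L) * f \<xi> + 4 * (L + M) * \<tau>"
        by (simp add: algebra_simps)
    qed auto
    finally show "(\<Sum>\<xi>\<in>?S. f \<xi> * exp (t * f \<xi>))
      \<le> t * (\<Sum>\<xi>\<in>?S. (\<sigma> * (4 * L) * f \<xi> + 4 * (L + M) * \<tau>) * exp (t * f \<xi>))" .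
  next
    have "0 \<le> L * \<theta>" using assms by simp
    then show "1 - 4 * L * \<theta> \<le> 1 - \<sigma> * (4 * L) * \<theta>" "1 - 4 * L * \<theta> \<le> 1"
      using K by auto
  qed (use assms finite_sign_vectors \<tau>0 M0 in auto)
  have "{\<xi>\<in>?S. r \<le> \<bar>(norm (R *v \<xi>))\<^sup>2 - \<tau>\<bar>}
    \<subseteq> {\<xi>\<in>?S. r \<le> \<xi> \<bullet> (H *v \<xi>)} \<union> {\<xi>\<in>?S. r \<le> \<xi> \<bullet> (- H *v \<xi>)}"
    (is "?A \<subseteq> ?B \<union> ?C")
  proof -
    have "(- H) *v \<xi> = - (H *v \<xi>)" for \<xi> by (simp add: vec_eq_iff matrix_vector_mult_def sum_negf)
    then show ?thesis using F by (auto simp: abs_if split: if_splits)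
  qed
  then have "card ?A \<le> card (?B \<union> ?C)"
    by (intro card_mono) (auto intro: finite_subset[OF _ finite_sign_vectors])
  also have "\<dots> \<le> card ?B + card ?C" by (rule card_Un_le)
  finally have "real (card ?A) \<le> real (card ?B) + real (card ?C)" by linarith
  also have "\<dots> \<le> real (card ?S) * exp (- s) + real (card ?S) * exp (- s)"
    by (intro add_mono tail[of _ H 1] tail[of _ "- H" "- 1"]) auto
  finally show ?thesis by simp
qed

subsection \<open>Random permutations\<close>

abbreviation perms :: "('d::finite \<Rightarrow> 'd) set" where
  "perms \<equiv> {p. p permutes UNIV}"

definition swap_perm :: "'d \<Rightarrow> 'd \<Rightarrow> ('d \<Rightarrow> 'd) \<Rightarrow> 'd \<Rightarrow> 'd" where
  "swap_perm k l p = p \<circ> Transposition.transpose k l"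

lemma swap_perm_apply:
  "swap_perm k l p j = (if j = k then p l else if j = l then p k else p j)"
  by (auto simp: swap_perm_def Transposition.transpose_def)

lemma swap_perm_swap_perm [simp]: "swap_perm k l (swap_perm k l p) = p"
  by (auto simp: swap_perm_apply fun_eq_iff)

lemma swap_perm_permutes [simp]: "swap_perm k l p \<in> perms \<longleftrightarrow> p \<in> (perms :: ('d::finite \<Rightarrow> 'd) set)"
proof -
  have "swap_perm k l p \<in> perms" if "p \<in> perms" for p :: "'d \<Rightarrow> 'd"
    using that unfolding swap_perm_def by (auto intro!: permutes_compose permutes_swap_id)
  from this[of p] this[of "swap_perm k l p"] show ?thesis by auto
qed

lemma sum_perms_swap:
  "(\<Sum>p\<in>perms. g (swap_perm k l p)) = (\<Sum>p\<in>perms. g (p :: 'd::finite \<Rightarrow> 'd))"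
  by (rule sum.reindex_bij_witness[of _ "swap_perm k l" "swap_perm k l"])
    (simp_all only: swap_perm_swap_perm swap_perm_permutes)

lemma sum_perms_compose:
  fixes u :: "'d::finite \<Rightarrow> real"
  assumes "p \<in> perms"
  shows "(\<Sum>k\<in>UNIV. u (p k)) = (\<Sum>k\<in>UNIV. u k)"
  using assms by (intro sum.reindex_bij_betw permutes_imp_bij) simp

text \<open>The pair \<open>(p, swap_perm k l p)\<close> is exchangeable.\<close>
lemma perm_exchange:
  fixes u :: "'d::finite \<Rightarrow> real" and h :: "'d \<Rightarrow> ('d \<Rightarrow> 'd) \<Rightarrow> real"
  assumes u: "(\<Sum>k\<in>UNIV. u k) = 1"
  shows "real CARD('d) * (\<Sum>p\<in>perms. \<Sum>k\<in>UNIV. u (p k) * h k p) - (\<Sum>p\<in>perms. \<Sum>k\<in>UNIV. h k p)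
    = (\<Sum>k\<in>UNIV. \<Sum>l\<in>UNIV. \<Sum>p\<in>perms.
        (u (p k) - u (p l)) * ((h k p - h l p) - (h k (swap_perm k l p) - h l (swap_perm k l p)))) / 4"
proof -
  define Q where "Q k l p = (u (p k) - u (p l)) * (h k p - h l p)" for k l p
  define Q' where "Q' k l p = (u (p k) - u (p l)) * (h k (swap_perm k l p) - h l (swap_perm k l p))" for k l p
  have "(\<Sum>k\<in>UNIV. \<Sum>l\<in>UNIV. (u (p k) - u (p l)) * h k p)
      = real CARD('d) * (\<Sum>k\<in>UNIV. u (p k) * h k p) - (\<Sum>k\<in>UNIV. h k p)" if "p \<in> perms" for p
  proof -
    have "(\<Sum>l\<in>UNIV. (u (p k) - u (p l)) * h k p)
       = real CARD('d) * (u (p k) * h k p) - (\<Sum>l\<in>UNIV. u (p l)) * h k p" for k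
      by (simp add: left_diff_distrib sum_subtractf sum_distrib_right)
    then show ?thesis
      using sum_perms_compose[OF that, of u] u by (simp add: sum_subtractf sum_distrib_left)
  qed
  then have lhs: "real CARD('d) * (\<Sum>p\<in>perms. \<Sum>k\<in>UNIV. u (p k) * h k p) - (\<Sum>p\<in>perms. \<Sum>k\<in>UNIV. h k p)
      = (\<Sum>p\<in>perms. \<Sum>k\<in>UNIV. \<Sum>l\<in>UNIV. (u (p k) - u (p l)) * h k p)"
    by (simp add: sum_distrib_left sum_subtractf[symmetric])
  \<comment> \<open>The factor 4 of the statement arises in two halves: symmetrising in k and l
    gives the first, and the swap of p, under which u (p k) - u (p l) changes sign, gives the
    second.\<close>
  have half: "(\<Sum>k\<in>UNIV. \<Sum>l\<in>UNIV. Q k l p) = 2 * (\<Sum>k\<in>UNIV. \<Sum>l\<in>UNIV. (u (p k) - u (p l)) * h k p)" for p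
  proof -
    have "(\<Sum>k\<in>UNIV. \<Sum>l\<in>UNIV. (u (p k) - u (p l)) * h l p)
       = - (\<Sum>k\<in>UNIV. \<Sum>l\<in>UNIV. (u (p k) - u (p l)) * h k p)"
      by (subst sum.swap) (simp add: sum_negf[symmetric] minus_diff_eq algebra_simps)
    then show ?thesis unfolding Q_def by (simp add: right_diff_distrib sum_subtractf)
  qed
  have "(\<Sum>p\<in>perms. Q k l p) = - (\<Sum>p\<in>perms. Q' k l p)" for k l
  proof -
    have "Q k l (swap_perm k l p) = - Q' k l p" for p
      by (auto simp: Q_def Q'_def swap_perm_apply algebra_simps)
    then show ?thesis
      using sum_perms_swap[of "Q k l" k l] by (simp add: sum_negf)
  qed
  then have "(\<Sum>k\<in>UNIV. \<Sum>l\<in>UNIV. \<Sum>p\<in>perms. Q k l p - Q' k l p) = 2 * (\<Sum>k\<in>UNIV. \<Sum>l\<in>UNIV. \<Sum>p\<in>perms. Q k l p)"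
    by (simp add: sum_subtractf sum_negf sum_distrib_left)
  also have "\<dots> = 2 * (\<Sum>k\<in>UNIV. \<Sum>p\<in>perms. \<Sum>l\<in>UNIV. Q k l p)"
    by (subst (2) sum.swap) simp
  also have "\<dots> = 2 * (\<Sum>p\<in>perms. \<Sum>k\<in>UNIV. \<Sum>l\<in>UNIV. Q k l p)"
    by (subst sum.swap) simp
  also have "\<dots> = 4 * (\<Sum>p\<in>perms. \<Sum>k\<in>UNIV. \<Sum>l\<in>UNIV. (u (p k) - u (p l)) * h k p)"
    by (simp add: half sum_distrib_left)
  finally show ?thesis
    unfolding lhs Q_def Q'_def by (simp add: right_diff_distrib)
qed

text \<open>Only one of the two factors is bounded by \<mu>. The other keeps the estimate linear in
  \<open>u\<close>, so that summing it over all pairs returns the original statistic instead of a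
  worst-case constant.\<close>

lemma square_diff_le:
  fixes u :: "'d \<Rightarrow> real"
  assumes u0: "\<And>k. 0 \<le> u k" and u1: "\<And>k. u k \<le> \<mu>"
  shows "(u k - u l)\<^sup>2 \<le> \<mu> * (u k + u l)"
proof -
  have "(u k - u l)\<^sup>2 = \<bar>u k - u l\<bar> * \<bar>u k - u l\<bar>" by (simp add: power2_eq_square)
  also have "\<dots> \<le> \<mu> * (u k + u l)"
    using u0[of k] u0[of l] u1[of k] u1[of l] by (intro mult_mono) auto
  finally show ?thesis .
qed

text \<open>A self-bounding Bernstein inequality for the sum Y, whose mean is 1. A swap changes Y by
  (u (p k) - u (p l)) (b k - b l); by \<open>square_diff_le\<close> for \<open>u\<close> and for
  \<open>b\<close>, the squares sum to at most 2 d M (Y + 1). This is affine in Y and yields \<beta>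
  = M and \<alpha> = M / 2, with a minus sign for the lower tail.\<close>

lemma permutation_sum_tail:
  fixes u b :: "'d::finite \<Rightarrow> real"
  assumes u0: "\<And>k. 0 \<le> u k" and u1: "\<And>k. u k \<le> \<mu>" and usum: "(\<Sum>k\<in>UNIV. u k) = 1"
    and b0: "\<And>k. 0 \<le> b k" and b1: "\<And>k. b k \<le> \<kappa>" and bsum: "(\<Sum>k\<in>UNIV. b k) = real CARD('d)"
    and M: "\<kappa> * \<mu> \<le> M" and \<theta>: "0 \<le> \<theta>" "M * \<theta> < 2"
    and s: "M * \<theta>\<^sup>2 / (2 * (1 - M / 2 * \<theta>)) + s \<le> \<theta> * r"
  shows "real (card {p\<in>perms. r \<le> \<bar>(\<Sum>k\<in>UNIV. u (p k) * b k) - 1\<bar>})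
    \<le> 2 * real (card (perms :: ('d \<Rightarrow> 'd) set)) * exp (- s)"
proof -
  let ?P = "perms :: ('d \<Rightarrow> 'd) set"
  define Y where "Y p = (\<Sum>k\<in>UNIV. u (p k) * b k)" for p
  have \<kappa>0: "0 \<le> \<kappa>" using b0 b1 order_trans by blast
  have \<mu>0: "0 \<le> \<mu>" using u0 u1 order_trans by blast
  have M0: "0 \<le> M" using M \<kappa>0 \<mu>0 by (meson mult_nonneg_nonneg order_trans)
  have Ydiff: "Y p - Y (swap_perm k l p) = (u (p k) - u (p l)) * (b k - b l)" for k l p
  proof (cases "k = l")
    case True
    have "swap_perm k k p = p" by (auto simp: swap_perm_apply)
    with True show ?thesis by simp
  next
    case False
    have "Y p - Y (swap_perm k l p) = (\<Sum>j\<in>UNIV. (if j = k then (u (p k) - u (p l)) * b k else 0)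
       + (if j = l then (u (p l) - u (p k)) * b l else 0))"
      unfolding Y_def sum_subtractf[symmetric]
      by (intro sum.cong) (use False in \<open>auto simp: swap_perm_apply algebra_simps\<close>)
    also have "\<dots> = (u (p k) - u (p l)) * b k + (u (p l) - u (p k)) * b l"
      by (simp add: sum.distrib)
    finally show ?thesis by (simp add: algebra_simps)
  qed
  have tail: "real (card {p\<in>?P. r \<le> \<sigma> * (Y p - 1)}) \<le> real (card ?P) * exp (- s)"
    if \<sigma>: "\<sigma> = 1 \<or> \<sigma> = (-1::real)" for \<sigma>
  proof (rule mgf_tail[where \<theta> = \<theta> and \<gamma> = "1 - M / 2 * \<theta>" and \<alpha> = "\<sigma> * (M / 2)" and \<beta> = M])
    fix t :: real assume t: "0 \<le> t"
    define f where "f p = \<sigma> * (Y p - 1)" for p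
    define e where "e p = exp (t * f p)" for p
    let ?d = "real CARD('d)"
    have hsum: "(\<Sum>k\<in>UNIV. \<sigma> * b k * e p) = ?d * \<sigma> * e p" for p
      by (simp add: sum_distrib_left[symmetric] sum_distrib_right[symmetric] bsum)
    have usum': "(\<Sum>k\<in>UNIV. u (p k) * (\<sigma> * b k * e p)) = \<sigma> * Y p * e p" for p
      by (simp add: Y_def sum_distrib_left sum_distrib_right algebra_simps)
    \<comment> \<open>The choice h k p = \<sigma> b k e p turns the left side of
      \<open>perm_exchange\<close> into d times the derivative of the moment generating function:
      the weighted sum produces \<sigma> Y, the plain sum the centering.\<close>
    have "?d * (\<Sum>p\<in>?P. f p * e p) = ?d * (\<Sum>p\<in>?P. \<Sum>k\<in>UNIV. u (p k) * (\<sigma> * b k * e p))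
        - (\<Sum>p\<in>?P. \<Sum>k\<in>UNIV. \<sigma> * b k * e p)"
      unfolding usum' hsum f_def
      by (simp add: algebra_simps sum_subtractf sum_distrib_left)
    also have "\<dots> = (\<Sum>k\<in>UNIV. \<Sum>l\<in>UNIV. \<Sum>p\<in>?P. (u (p k) - u (p l)) *
        ((\<sigma> * b k * e p - \<sigma> * b l * e p) - (\<sigma> * b k * e (swap_perm k l p) - \<sigma> * b l * e (swap_perm k l p)))) / 4"
      by (rule perm_exchange[OF usum])
    also have "\<dots> = (\<Sum>k\<in>UNIV. \<Sum>l\<in>UNIV. \<Sum>p\<in>?P. (f p - f (swap_perm k l p)) * (e p - e (swap_perm k l p))) / 4"
    proof -
      have "f p - f (swap_perm k l p) = \<sigma> * ((u (p k) - u (p l)) * (b k - b l))" for k l p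
        unfolding f_def Ydiff[symmetric] by (simp add: algebra_simps)
      then have "(u (p k) - u (p l)) *
          ((\<sigma> * b k * e p - \<sigma> * b l * e p) - (\<sigma> * b k * e (swap_perm k l p) - \<sigma> * b l * e (swap_perm k l p)))
        = (f p - f (swap_perm k l p)) * (e p - e (swap_perm k l p))" for k l p
        by (simp only:) (simp add: algebra_simps)
      then show ?thesis by simp
    qed
    also have "\<dots> \<le> (\<Sum>k\<in>UNIV. \<Sum>l\<in>UNIV. \<Sum>p\<in>?P. t * (f p - f (swap_perm k l p))\<^sup>2 * (e p + e (swap_perm k l p)) / 2) / 4"
    proof (intro divide_right_mono sum_mono)
      fix k l p
      show "(f p - f (swap_perm k l p)) * (e p - e (swap_perm k l p))
        \<le> t * (f p - f (swap_perm k l p))\<^sup>2 * (e p + e (swap_perm k l p)) / 2" (is "?x \<le> ?y")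
      proof (cases "t = 0")
        case False
        with t have "0 < t" by simp
        moreover have "t * ?x \<le> t * ?y"
        proof -
          have "t * ?x = (t * f p - t * f (swap_perm k l p)) * (e p - e (swap_perm k l p))"
            by (simp add: algebra_simps)
          also have "\<dots> \<le> (t * f p - t * f (swap_perm k l p))\<^sup>2 * (e p + e (swap_perm k l p)) / 2"
            unfolding e_def by (rule exp_trapezoid)
          also have "\<dots> = t * ?y"
            by (simp add: power2_eq_square flip: right_diff_distrib)
          finally show ?thesis .
        qed
        ultimately show ?thesis by (simp only: mult_le_cancel_left_pos)
      qed (simp add: e_def)
    qed simp
    also have "\<dots> = (\<Sum>k\<in>UNIV. \<Sum>l\<in>UNIV. \<Sum>p\<in>?P. t * (f p - f (swap_perm k l p))\<^sup>2 * e p) / 4"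
    proof -
      have "(\<Sum>p\<in>?P. t * (f p - f (swap_perm k l p))\<^sup>2 * (e p + e (swap_perm k l p)) / 2)
        = (\<Sum>p\<in>?P. t * (f p - f (swap_perm k l p))\<^sup>2 * e p)" for k l
        using sum_perms_swap[of "\<lambda>p. t * (f p - f (swap_perm k l p))\<^sup>2 * e p" k l]
        by (simp add: distrib_left sum.distrib power2_commute add_divide_distrib flip: sum_divide_distrib)
      then show ?thesis by simp
    qed
    also have "\<dots> \<le> (\<Sum>k\<in>UNIV. \<Sum>l\<in>UNIV. \<Sum>p\<in>?P. t * (M * (u (p k) + u (p l)) * (b k + b l)) * e p) / 4"
    proof (intro divide_right_mono sum_mono mult_right_mono mult_left_mono[OF _ t])
      fix k l p
      have "(f p - f (swap_perm k l p))\<^sup>2 = (Y p - Y (swap_perm k l p))\<^sup>2"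
        using \<sigma> by (auto simp: f_def power2_commute)
      also have "\<dots> = (u (p k) - u (p l))\<^sup>2 * (b k - b l)\<^sup>2"
        by (simp add: Ydiff power_mult_distrib)
      also have "\<dots> \<le> (\<mu> * (u (p k) + u (p l))) * (\<kappa> * (b k + b l))"
        by (intro mult_mono square_diff_le[of "u"] square_diff_le[of b] u0 u1 b0 b1)
          (auto simp: u0 \<mu>0)
      also have "\<dots> = (\<kappa> * \<mu>) * ((u (p k) + u (p l)) * (b k + b l))" by simp
      also have "\<dots> \<le> M * ((u (p k) + u (p l)) * (b k + b l))"
        by (intro mult_right_mono M) (auto simp: u0 b0)
      finally show "(f p - f (swap_perm k l p))\<^sup>2 \<le> M * (u (p k) + u (p l)) * (b k + b l)"
        by (simp add: mult.assoc)
    qed (simp_all add: e_def)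
    also have "\<dots> = (\<Sum>p\<in>?P. t * M * (\<Sum>k\<in>UNIV. \<Sum>l\<in>UNIV. (u (p k) + u (p l)) * (b k + b l)) * e p) / 4"
    proof -
      have "(\<Sum>p\<in>?P. t * M * (\<Sum>k\<in>UNIV. \<Sum>l\<in>UNIV. (u (p k) + u (p l)) * (b k + b l)) * e p)
        = (\<Sum>p\<in>?P. \<Sum>k\<in>UNIV. \<Sum>l\<in>UNIV. t * (M * (u (p k) + u (p l)) * (b k + b l)) * e p)"
        by (simp add: sum_distrib_left sum_distrib_right mult.assoc)
      also have "\<dots> = (\<Sum>k\<in>UNIV. \<Sum>l\<in>UNIV. \<Sum>p\<in>?P. t * (M * (u (p k) + u (p l)) * (b k + b l)) * e p)"
        by (subst sum.swap) (subst (2) sum.swap, rule refl)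
      finally show ?thesis by simp
    qed
    also have "\<dots> = (\<Sum>p\<in>?P. t * M * (2 * ?d * (Y p + 1)) * e p) / 4"
    proof -
      have "(\<Sum>k\<in>UNIV. \<Sum>l\<in>UNIV. (u (p k) + u (p l)) * (b k + b l)) = 2 * ?d * (Y p + 1)"
        if "p \<in> ?P" for p
      proof -
        have up: "(\<Sum>k\<in>UNIV. u (p k)) = 1" using sum_perms_compose[OF that, of u] usum by simp
        have "(\<Sum>l\<in>UNIV. (u (p k) + u (p l)) * (b k + b l)) = ?d * (u (p k) * b k) + u (p k) * ?d + b k + Y p" for k
          by (simp only: distrib_left distrib_right sum.distrib up bsum Y_def
              sum_distrib_left[symmetric] sum_distrib_right[symmetric] sum_constant) simp
        then show ?thesis
          by (simp only: sum.distrib up bsum Y_def[symmetric]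
              sum_distrib_left[symmetric] sum_distrib_right[symmetric] sum_constant)
            (simp add: distrib_left)
      qed
      then show ?thesis by simp
    qed
    also have "\<dots> = ?d * (t * (\<Sum>p\<in>?P. (\<sigma> * (M / 2) * f p + M) * e p))"
    proof -
      have "\<sigma> * (M / 2) * f p + M = M / 2 * (Y p + 1)" for p
        using \<sigma> by (elim disjE) (simp_all add: f_def field_simps)
      then have "t * M * (2 * ?d * (Y p + 1)) * e p / 4 = ?d * (t * ((\<sigma> * (M / 2) * f p + M) * e p))" for p
        by (simp only:) simp
      then show ?thesis by (simp only: sum_distrib_left sum_divide_distrib)
    qed
    finally have "(\<Sum>p\<in>?P. f p * e p) \<le> t * (\<Sum>p\<in>?P. (\<sigma> * (M / 2) * f p + M) * e p)"
      by (simp only: mult_le_cancel_left_pos of_nat_0_less_iff zero_less_card_finite)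
    then show "(\<Sum>p\<in>?P. \<sigma> * (Y p - 1) * exp (t * (\<sigma> * (Y p - 1))))
      \<le> t * (\<Sum>p\<in>?P. (\<sigma> * (M / 2) * (\<sigma> * (Y p - 1)) + M) * exp (t * (\<sigma> * (Y p - 1))))"
      unfolding e_def f_def .
  next
    have "0 \<le> M * \<theta>" using \<theta> M0 by simp
    then show "1 - M / 2 * \<theta> \<le> 1 - \<sigma> * (M / 2) * \<theta>" "1 - M / 2 * \<theta> \<le> 1"
      using \<sigma> by auto
  qed (use \<theta> M0 s in \<open>auto simp: finite_permutes_UNIV\<close>)
  have "{p\<in>?P. r \<le> \<bar>Y p - 1\<bar>} \<subseteq> {p\<in>?P. r \<le> 1 * (Y p - 1)} \<union> {p\<in>?P. r \<le> -1 * (Y p - 1)}"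
    (is "?A \<subseteq> ?B \<union> ?C")
    by auto
  then have "card ?A \<le> card (?B \<union> ?C)"
    by (intro card_mono) (auto intro: finite_subset[OF _ finite_permutes_UNIV])
  also have "\<dots> \<le> card ?B + card ?C" by (rule card_Un_le)
  finally have "real (card ?A) \<le> real (card ?B) + real (card ?C)" by linarith
  also have "\<dots> \<le> real (card ?P) * exp (- s) + real (card ?P) * exp (- s)"
    by (intro add_mono tail) auto
  finally show ?thesis by (simp add: Y_def algebra_simps)
qed

subsection \<open>Matrix powers and traces\<close>

lemma bounded_bilinear_matrix_mult:
  "bounded_bilinear ((**) :: real ^ 'n ^ 'm \<Rightarrow> real ^ 'k ^ 'n \<Rightarrow> real ^ 'k ^ 'm)"
  unfolding bilinear_conv_bounded_bilinear[symmetric] bilinear_def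
  by (intro conjI allI linearI)
    (simp_all add: matrix_add_ldistrib matrix_scalar_ac scalar_matrix_assoc[symmetric],
     simp add: matrix_matrix_mult_def vec_eq_iff distrib_right sum.distrib)

interpretation mm: bounded_bilinear "(**) :: real ^ 'n ^ 'm \<Rightarrow> real ^ 'k ^ 'n \<Rightarrow> real ^ 'k ^ 'm"
  by (rule bounded_bilinear_matrix_mult)

lemma linear_trace: "linear (trace :: real ^ 'n ^ 'n \<Rightarrow> real)"
  by (intro linearI) (simp_all add: trace_def sum.distrib sum_distrib_left)

primrec mpow :: "real ^ 'n ^ 'n \<Rightarrow> nat \<Rightarrow> real ^ 'n ^ 'n" where
  "mpow X 0 = mat 1"
| "mpow X (Suc n) = X ** mpow X n"

lemma mpow_add: "mpow X (i + j) = mpow X i ** mpow X j"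
  by (induction i) (simp_all add: matrix_mul_assoc)

lemma mpow_Suc': "mpow X (Suc n) = mpow X n ** X"
  using mpow_add[of X n 1] by simp

lemma transpose_mpow: "transpose X = X \<Longrightarrow> transpose (mpow X n) = mpow X n"
proof (induction n)
  case (Suc n)
  have "transpose (mpow X (Suc n)) = transpose (mpow X n) ** transpose X"
    by (simp add: matrix_transpose_mul)
  with Suc show ?case unfolding mpow_Suc' by simp
qed simp

text \<open>An even power is the square of a symmetric matrix; an odd power is such a square with
  the factor S ** transpose S placed in the middle. The factors have different shapes, m by m or m
  by d, hence a case rule with two differently typed \<open>C\<close>. It supplies positivity of
  powers without a spectral decomposition.\<close>

lemma gram_mpow_cases:
  fixes S :: "real ^ 'd ^ 'm"
  assumes X: "X = S ** transpose S"
  obtains (even) C :: "real ^ 'm ^ 'm" where "mpow X n = C ** transpose C"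
    | (odd) C :: "real ^ 'd ^ 'm" where "mpow X n = C ** transpose C"
proof (cases "even n")
  case True
  then obtain b where n: "n = b + b" by (metis evenE mult_2)
  have "transpose X = X" by (simp add: X matrix_transpose_mul)
  then have "mpow X n = mpow X b ** transpose (mpow X b)"
    by (simp add: n mpow_add transpose_mpow)
  then show ?thesis by (rule that)
next
  case False
  then obtain b where n: "n = b + Suc b" by (metis oddE mult_2 add_Suc_right Suc_eq_plus1)
  have "transpose X = X" by (simp add: X matrix_transpose_mul)
  then have "mpow X n = (mpow X b ** S) ** transpose (mpow X b ** S)"
    unfolding n mpow_add mpow_Suc' matrix_transpose_mul transpose_mpow[OF \<open>transpose X = X\<close>]
    by (metis X matrix_mul_assoc mpow_Suc' mpow.simps(2))
  then show ?thesis by (rule that)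
qed

lemma gram_quadratic: "v \<bullet> ((C ** transpose C) *v v) = (norm (transpose C *v v))\<^sup>2"
  for C :: "real ^ 'k ^ 'm"
  using dot_lmul_matrix[of v C "transpose C *v v"]
  by (simp add: matrix_vector_mul_assoc[symmetric] power2_norm_eq_inner)

lemma gram_mpow_psd:
  fixes S :: "real ^ 'd ^ 'm"
  assumes "X = S ** transpose S"
  shows "0 \<le> v \<bullet> (mpow X n *v v)"
  using assms by (cases rule: gram_mpow_cases[of X S n]) (simp_all add: gram_quadratic del: transpose_matrix_vector)

lemma trace_conj_nonneg:
  fixes C :: "real ^ 'k ^ 'm"
  assumes "\<And>v. 0 \<le> v \<bullet> (P *v v)"
  shows "0 \<le> trace (transpose C ** P ** C)"
proof -
  have "(transpose C ** P ** C) $ i $ i = column i C \<bullet> (P *v column i C)" for i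
    unfolding matrix_mul_assoc[symmetric]
    by (simp add: matrix_matrix_mult_def matrix_vector_mult_def transpose_def column_def inner_vec_def)
  then show ?thesis using assms by (auto simp: trace_def intro!: sum_nonneg)
qed

text \<open>Cyclicity of the trace moves transpose C to the front. What is left is a sum of values
  of the quadratic form of \<open>P\<close> at the columns of W ** C.\<close>

lemma trace_psd_mult_gram_nonneg:
  fixes C :: "real ^ 'k ^ 'm"
  assumes "\<And>v. 0 \<le> v \<bullet> (P *v v)"
  shows "0 \<le> trace (transpose W ** P ** W ** (C ** transpose C))"
proof -
  have "trace (transpose W ** P ** W ** (C ** transpose C)) = trace ((transpose W ** P ** W ** C) ** transpose C)"
    by (simp add: matrix_mul_assoc)
  also have "\<dots> = trace (transpose (W ** C) ** P ** (W ** C))"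
    by (subst trace_mul_sym) (simp add: matrix_mul_assoc matrix_transpose_mul)
  finally show ?thesis using trace_conj_nonneg[OF assms] by simp
qed

lemma trace_psd_gram_nonneg:
  fixes S :: "real ^ 'd ^ 'm"
  assumes "\<And>v. 0 \<le> v \<bullet> (P *v v)" and "Y = S ** transpose S"
  shows "0 \<le> trace (transpose W ** P ** W ** mpow Y n)"
  using assms(2) by (cases rule: gram_mpow_cases[of Y S n])
    (simp_all only: trace_psd_mult_gram_nonneg[OF assms(1)])

text \<open>Pair i with n - i. Since the increments are nondecreasing, the first i of them sum to at
  most the last i, so f i + f (n - i) \<le> f 0 + f n.\<close>

lemma sum_discrete_convex:
  fixes f :: "nat \<Rightarrow> real"
  assumes conv: "\<And>i. i + 2 \<le> n \<Longrightarrow> 2 * f (i + 1) \<le> f i + f (i + 2)"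
  shows "2 * (\<Sum>i\<le>n. f i) \<le> real (n + 1) * (f 0 + f n)"
proof -
  define g where "g i = f (Suc i) - f i" for i
  have mono: "g i \<le> g (i + k)" if "i + k < n" for i k
    using that
  proof (induction k)
    case (Suc k)
    then have "g i \<le> g (i + k)" by simp
    also have "\<dots> \<le> g (i + Suc k)" using conv[of "i + k"] Suc.prems by (simp add: g_def)
    finally show ?case .
  qed simp
  have sums: "f (a + i) - f a = (\<Sum>j<i. g (a + j))" for a i
    by (induction i) (simp_all add: g_def)
  have pair: "f i + f (n - i) \<le> f 0 + f n" if "i \<le> n" for i
  proof -
    have "f i - f 0 = (\<Sum>j<i. g j)" using sums[of 0 i] by simp
    also have "\<dots> \<le> (\<Sum>j<i. g (n - i + j))"
    proof (rule sum_mono)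
      fix j assume "j \<in> {..<i}"
      then show "g j \<le> g (n - i + j)" using mono[of j "n - i"] that by (simp add: add.commute)
    qed
    also have "\<dots> = f n - f (n - i)" using sums[of "n - i" i] that by simp
    finally show ?thesis by simp
  qed
  have "(\<Sum>i\<le>n. f (n - i)) = (\<Sum>i\<le>n. f i)"
    by (rule sum.reindex_bij_witness[of _ "\<lambda>i. n - i" "\<lambda>i. n - i"]) auto
  then have "2 * (\<Sum>i\<le>n. f i) = (\<Sum>i\<le>n. f i + f (n - i))" by (simp add: sum.distrib)
  also have "\<dots> \<le> (\<Sum>i\<le>n. f 0 + f n)" by (intro sum_mono pair) auto
  finally show ?thesis by simp
qed

lemma mpow_diff:
  "mpow X (Suc n) - mpow Y (Suc n) = (\<Sum>i\<le>n. mpow X i ** (X - Y) ** mpow Y (n - i))"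
proof (induction n)
  case (Suc n)
  have "mpow X (Suc (Suc n)) - mpow Y (Suc (Suc n))
    = (X - Y) ** mpow Y (Suc n) + X ** (mpow X (Suc n) - mpow Y (Suc n))"
    by (simp add: mm.diff_left mm.diff_right)
  also have "X ** (mpow X (Suc n) - mpow Y (Suc n)) = (\<Sum>i\<le>n. mpow X (Suc i) ** (X - Y) ** mpow Y (n - i))"
    unfolding Suc by (simp add: mm.sum_right matrix_mul_assoc)
  finally show ?case by (subst sum.atMost_Suc_shift) simp
qed (simp add: mm.diff_left)

text \<open>
  With \<open>\<phi> i = tr (Z X\<^sup>i Z Y\<^sup>n\<^sup>-\<^sup>i)\<close> and \<open>Z = X - Y\<close>, the left side is \<open>\<Sum>i\<le>n. \<phi> i\<close>; the second differences of \<open>\<phi>\<close>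
  are \<open>tr (W\<^sup>T X\<^sup>i W Y\<^sup>n\<^sup>-\<^sup>i\<^sup>-\<^sup>2)\<close> with \<open>W = X Z - Z Y\<close>, so \<open>\<phi>\<close> is convex and the trapezoidal rule applies.
\<close>
lemma trace_mean_value:
  fixes S T :: "real ^ 'd ^ 'm"
  assumes X: "X = S ** transpose S" and Y: "Y = T ** transpose T"
  shows "2 * trace ((X - Y) ** (mpow X (Suc n) - mpow Y (Suc n)))
    \<le> real (n + 1) * trace (((X - Y) ** (X - Y)) ** (mpow X n + mpow Y n))"
proof -
  define Z where "Z = X - Y"
  define \<phi> where "\<phi> i = trace (Z ** mpow X i ** Z ** mpow Y (n - i))" for i
  have sX: "transpose X = X" and sY: "transpose Y = Y" by (simp_all add: X Y matrix_transpose_mul)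
  have sZ: "transpose Z = Z"
    using sX sY by (simp add: Z_def transpose_def vec_eq_iff)
  have "trace (Z ** (mpow X (Suc n) - mpow Y (Suc n))) = (\<Sum>i\<le>n. \<phi> i)"
    unfolding mpow_diff Z_def[symmetric] \<phi>_def mm.sum_right linear_sum[OF linear_trace]
    by (simp add: matrix_mul_assoc)
  moreover have "2 * (\<Sum>i\<le>n. \<phi> i) \<le> real (n + 1) * (\<phi> 0 + \<phi> n)"
  proof (rule sum_discrete_convex)
    fix i assume i: "i + 2 \<le> n"
    define W where "W = X ** Z - Z ** Y"
    define Q where "Q = mpow Y (n - (i + 2))"
    have Q1: "mpow Y (n - (i + 1)) = Y ** Q" and Q2: "mpow Y (n - i) = Y ** (Y ** Q)"
      using i by (simp_all add: Q_def flip: mpow.simps(2)) (simp_all add: Suc_diff_le numeral_2_eq_2 Suc_diff_Suc)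
    have P1: "mpow X (i + 1) = X ** mpow X i" and P2: "mpow X (i + 2) = X ** mpow X i ** X"
      using mpow_Suc'[of X "Suc i"] by simp_all
    have P1': "mpow X i ** X = X ** mpow X i" using mpow_Suc'[of X i] by simp
    have Q1': "Q ** Y = Y ** Q" unfolding Q_def using mpow_Suc'[of Y "n - (i + 2)"] by simp
    have tW: "transpose W = Z ** X - Y ** Z"
    proof -
      have "transpose (A - B) = transpose A - transpose B" for A B :: "real ^ 'm ^ 'm"
        by (simp add: transpose_def vec_eq_iff)
      then show ?thesis by (simp add: W_def matrix_transpose_mul sX sY sZ)
    qed
    have c1: "trace (Y ** A) = trace (A ** Y)" for A :: "real ^ 'm ^ 'm" by (rule trace_mul_sym)
    have "trace (transpose W ** mpow X i ** W ** Q)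
      = trace (Z ** X ** mpow X i ** X ** Z ** Q) - trace (Z ** X ** mpow X i ** Z ** Y ** Q)
        - (trace (Y ** (Z ** mpow X i ** X ** Z ** Q)) - trace (Y ** (Z ** mpow X i ** Z ** Y ** Q)))"
      unfolding tW unfolding W_def by (simp add: mm.diff_left mm.diff_right trace_sub matrix_mul_assoc)
    also have "\<dots> = \<phi> (i + 2) - \<phi> (i + 1) - (\<phi> (i + 1) - \<phi> i)"
    proof -
      have "trace (Y ** (Z ** mpow X i ** X ** Z ** Q)) = \<phi> (i + 1)"
        unfolding c1 \<phi>_def P1 Q1 by (simp add: matrix_mul_assoc[symmetric] Q1' P1')
      moreover have "trace (Y ** (Z ** mpow X i ** Z ** Y ** Q)) = \<phi> i"
        unfolding c1 \<phi>_def Q2 by (simp add: matrix_mul_assoc[symmetric] Q1')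
      moreover have "trace (Z ** X ** mpow X i ** Z ** Y ** Q) = \<phi> (i + 1)"
        unfolding \<phi>_def P1 Q1 by (simp add: matrix_mul_assoc)
      moreover have "trace (Z ** X ** mpow X i ** X ** Z ** Q) = \<phi> (i + 2)"
        unfolding \<phi>_def P2 Q_def by (simp add: matrix_mul_assoc)
      ultimately show ?thesis by simp
    qed
    finally have "\<phi> (i + 2) - \<phi> (i + 1) - (\<phi> (i + 1) - \<phi> i) = trace (transpose W ** mpow X i ** W ** Q)" by simp
    moreover have "0 \<le> trace (transpose W ** mpow X i ** W ** Q)"
      unfolding Q_def by (rule trace_psd_gram_nonneg[OF gram_mpow_psd[OF X] Y])
    ultimately show "2 * \<phi> (i + 1) \<le> \<phi> i + \<phi> (i + 2)" by simp
  qed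
  moreover have "\<phi> 0 + \<phi> n = trace ((Z ** Z) ** (mpow X n + mpow Y n))"
  proof -
    have "\<phi> n = trace (Z ** (Z ** mpow X n))"
      unfolding \<phi>_def by (subst trace_mul_sym) (simp add: matrix_mul_assoc)
    then show ?thesis
      by (simp add: \<phi>_def mm.add_right trace_add matrix_mul_assoc)
  qed
  ultimately show ?thesis by (simp add: Z_def)
qed

text \<open>Cauchy-Schwarz for each column of \<open>C\<close>: the trace is the sum of the squared
  column norms. It plays the role of bounding the largest eigenvalue by the trace.\<close>

lemma gram_le_trace:
  fixes C :: "real ^ 'k ^ 'm"
  shows "v \<bullet> ((C ** transpose C) *v v) \<le> trace (C ** transpose C) * (norm v)\<^sup>2"
proof -
  have "(norm (transpose C *v v))\<^sup>2 = (\<Sum>k\<in>UNIV. (column k C \<bullet> v)\<^sup>2)"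
    unfolding power2_norm_eq_inner
    by (simp add: inner_vec_def vector_matrix_mult_def column_def power2_eq_square mult.commute)
  also have "\<dots> \<le> (\<Sum>k\<in>UNIV. (norm (column k C))\<^sup>2 * (norm v)\<^sup>2)"
    by (intro sum_mono) (metis Cauchy_Schwarz_ineq power2_norm_eq_inner)
  also have "\<dots> = (\<Sum>k\<in>UNIV. column k C \<bullet> column k C) * (norm v)\<^sup>2"
    by (simp add: sum_distrib_right power2_norm_eq_inner)
  also have "(\<Sum>k\<in>UNIV. column k C \<bullet> column k C) = trace (C ** transpose C)"
    unfolding trace_def
    by (simp add: inner_vec_def column_def matrix_matrix_mult_def transpose_def) (rule sum.swap)
  finally show ?thesis unfolding gram_quadratic .
qed

text \<open>The usual argument is Jensen's inequality for the spectral measure of \<open>X\<close>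
  at v. Here it is replaced by an induction on \<psi> n, the quadratic form of the n-th power at v:
  the defect \<psi> (n + 1) - c \<psi> n vanishes at n = 0 and stays nonnegative.\<close>

lemma gram_quadratic_power_le_trace:
  fixes S :: "real ^ 'd ^ 'm"
  assumes X: "X = S ** transpose S" and v: "norm v = 1"
  shows "(v \<bullet> (X *v v)) ^ n \<le> trace (mpow X n)"
proof -
  define c where "c = v \<bullet> (X *v v)"
  have c0: "0 \<le> c" using gram_mpow_psd[OF X, of v 1] by (simp add: c_def)
  define \<psi> where "\<psi> n = v \<bullet> (mpow X n *v v)" for n
  have vv: "v \<bullet> v = 1" using v by (simp add: dot_square_norm)
  have sX: "transpose X = X" by (simp add: X matrix_transpose_mul)
  have Xl: "(X *v a) \<bullet> b = a \<bullet> (X *v b)" for a b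
    using dot_lmul_matrix[of a X b] sX by (metis transpose_matrix_vector)
  \<comment> \<open>Positivity of \<open>mpow X n\<close> at the vector X v - c v, expanded, says
    that each defect is at least c times the previous one.\<close>
  have step: "c * (\<psi> (Suc n) - c * \<psi> n) \<le> \<psi> (Suc (Suc n)) - c * \<psi> (Suc n)" for n
  proof -
    have "0 \<le> (X *v v - c *\<^sub>R v) \<bullet> (mpow X n *v (X *v v - c *\<^sub>R v))"
      by (rule gram_mpow_psd[OF X])
    also have "\<dots> = (X *v v) \<bullet> (mpow X n *v (X *v v)) - c * ((X *v v) \<bullet> (mpow X n *v v))
       - (c * (v \<bullet> (mpow X n *v (X *v v))) - c * (c * \<psi> n))"
      by (simp add: \<psi>_def inner_diff_left inner_diff_right matrix_vector_mult_diff_distrib matrix_vector_mult_scaleR right_diff_distrib)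
    also have "(X *v v) \<bullet> (mpow X n *v (X *v v)) = \<psi> (Suc (Suc n))"
      unfolding \<psi>_def Xl by (simp add: matrix_vector_mul_assoc mpow_Suc'[symmetric] matrix_mul_assoc[symmetric] del: mpow.simps(2)) simp
    also have "(X *v v) \<bullet> (mpow X n *v v) = \<psi> (Suc n)"
      unfolding \<psi>_def Xl by (simp add: matrix_vector_mul_assoc)
    also have "v \<bullet> (mpow X n *v (X *v v)) = \<psi> (Suc n)"
      unfolding \<psi>_def mpow_Suc' by (simp add: matrix_vector_mul_assoc)
    finally show ?thesis by (simp add: algebra_simps)
  qed
  have D: "0 \<le> \<psi> (Suc n) - c * \<psi> n" for n
  proof (induction n)
    case 0
    show ?case by (simp add: \<psi>_def c_def vv)
  next
    case (Suc n)
    then show ?case using step[of n] c0 by (meson mult_nonneg_nonneg order_trans)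
  qed
  have "c ^ n \<le> \<psi> n" for n
  proof (induction n)
    case 0
    show ?case by (simp add: \<psi>_def vv)
  next
    case (Suc n)
    then have "c * c ^ n \<le> c * \<psi> n" by (intro mult_left_mono c0)
    also have "\<dots> \<le> \<psi> (Suc n)" using D[of n] by simp
    finally show ?case by simp
  qed
  also have "\<psi> n \<le> trace (mpow X n)"
  proof (rule gram_mpow_cases[OF X, of n])
    fix C :: "real ^ 'm ^ 'm" assume "mpow X n = C ** transpose C"
    then show ?thesis using gram_le_trace[of v C] v by (simp add: \<psi>_def)
  next
    fix C :: "real ^ 'd ^ 'm" assume "mpow X n = C ** transpose C"
    then show ?thesis using gram_le_trace[of v C] v by (simp add: \<psi>_def)
  qed
  finally show ?thesis by (simp add: c_def)
qed

section \<open>Rank-one matrices under the trace\<close>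

definition outer :: "real ^ 'm \<Rightarrow> real ^ 'm ^ 'm" where
  "outer w = (\<chi> i j. w $ i * w $ j)"

lemma outer_mult: "outer w ** P = (\<chi> i j. w $ i * (w v* P) $ j)"
  by (simp add: outer_def matrix_matrix_mult_def vector_matrix_mult_def vec_eq_iff sum_distrib_left mult.assoc)

lemma trace_outer_mult: "trace (outer w ** P) = w \<bullet> (P *v w)"
  unfolding dot_lmul_matrix[symmetric]
  by (simp add: outer_mult trace_def inner_vec_def mult.commute)

lemma outer_square: "outer w ** outer w = (norm w)\<^sup>2 *\<^sub>R outer w"
  by (simp add: outer_def matrix_matrix_mult_def vec_eq_iff power2_norm_eq_inner inner_vec_def sum_distrib_left sum_distrib_right algebra_simps)

text \<open>This is \<open>(V - V')\<^sup>2 \<le> 2 V\<^sup>2 + 2 V'\<^sup>2 \<le> 2 \<kappa> (V + V')\<close>, tested against a power of \<open>Y\<close>.\<close>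
lemma trace_outer_diff_square_le:
  fixes S :: "real ^ 'd ^ 'm"
  assumes Y: "Y = S ** transpose S" and v: "(norm v)\<^sup>2 \<le> \<kappa>" and w: "(norm w)\<^sup>2 \<le> \<kappa>"
  shows "trace (((outer v - outer w) ** (outer v - outer w)) ** mpow Y n)
    \<le> 2 * \<kappa> * (trace (outer v ** mpow Y n) + trace (outer w ** mpow Y n))"
proof -
  let ?Q = "mpow Y n"
  have "transpose (outer v + outer w) = outer v + outer w"
    by (simp add: outer_def transpose_def vec_eq_iff mult.commute)
  then have pos: "0 \<le> trace ((outer v + outer w) ** (outer v + outer w) ** ?Q)"
    using trace_psd_gram_nonneg[OF _ Y, of "mat 1" "outer v + outer w" n] by simp
  have parallelogram: "trace (((outer v - outer w) ** (outer v - outer w)) ** ?Q) + trace ((outer v + outer w) ** (outer v + outer w) ** ?Q)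
    = 2 * trace ((outer v ** outer v) ** ?Q) + 2 * trace ((outer w ** outer w) ** ?Q)"
    by (simp add: mm.diff_left mm.diff_right mm.add_left mm.add_right trace_add trace_sub)
  have square: "trace ((outer x ** outer x) ** ?Q) \<le> \<kappa> * trace (outer x ** ?Q)" if "(norm x)\<^sup>2 \<le> \<kappa>" for x
  proof -
    have "trace ((outer x ** outer x) ** ?Q) = (norm x)\<^sup>2 * trace (outer x ** ?Q)"
      unfolding outer_square scalar_matrix_assoc[symmetric] by (simp add: linear_cmul[OF linear_trace])
    also have "\<dots> \<le> \<kappa> * trace (outer x ** ?Q)"
      by (intro mult_right_mono that) (simp add: trace_outer_mult gram_mpow_psd[OF Y])
    finally show ?thesis .
  qed
  show ?thesis
    using pos parallelogram square[OF v] square[OF w] by (simp add: distrib_left)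
qed

subsection \<open>Trace moments of the sampled matrix\<close>

definition sampled_matrix :: "('d::finite \<Rightarrow> real) \<Rightarrow> ('d \<Rightarrow> real ^ 'm) \<Rightarrow> ('d \<Rightarrow> 'd) \<Rightarrow> real ^ 'm ^ 'm" where
  "sampled_matrix u w p = (\<Sum>k\<in>UNIV. u (p k) *\<^sub>R outer (w k))"

text \<open>A Gram factor of \<open>sampled_matrix\<close>, available because the weights are
  nonnegative; it makes the positivity results on Gram powers applicable.\<close>

definition sampled_factor :: "('d::finite \<Rightarrow> real) \<Rightarrow> ('d \<Rightarrow> real ^ 'm) \<Rightarrow> ('d \<Rightarrow> 'd) \<Rightarrow> real ^ 'd ^ 'm" where
  "sampled_factor u w p = (\<chi> i k. sqrt (u (p k)) * w k $ i)"

text \<open>Left unnormalised: the expected trace of the n-th power times the number of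
  permutations.\<close>

definition trace_moment :: "('d::finite \<Rightarrow> real) \<Rightarrow> ('d \<Rightarrow> real ^ 'm::finite) \<Rightarrow> nat \<Rightarrow> real" where
  "trace_moment u w n = (\<Sum>p\<in>perms. trace (mpow (sampled_matrix u w p) n))"

section \<open>The moment recursion for a tight frame \<open>w\<close> with permuted weights\<close>

context
  fixes u :: "'d::finite \<Rightarrow> real" and w :: "'d \<Rightarrow> real ^ 'm::finite" and \<mu> \<kappa> M c :: real
  assumes u0: "\<And>k. 0 \<le> u k" and u1: "\<And>k. u k \<le> \<mu>" and usum: "(\<Sum>k\<in>UNIV. u k) = 1"
    and w1: "\<And>k. (norm (w k))\<^sup>2 \<le> \<kappa>" and wsum: "(\<Sum>k\<in>UNIV. outer (w k)) = c *\<^sub>R mat 1"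
    and c: "c = real CARD('d) / real CARD('m)" and M: "\<kappa> * \<mu> \<le> M"
begin

lemma sampled_matrix_gram: "sampled_matrix u w p = sampled_factor u w p ** transpose (sampled_factor u w p)"
proof -
  have weight: "u (p k) * (x * y) = (sqrt (u (p k)) * x) * (sqrt (u (p k)) * y)" for k x y
  proof -
    have "(sqrt (u (p k)) * x) * (sqrt (u (p k)) * y) = (sqrt (u (p k)) * sqrt (u (p k))) * (x * y)"
      by (simp only: mult_ac)
    then show ?thesis using u0 by simp
  qed
  have "sampled_matrix u w p $ i $ j = (\<Sum>k\<in>UNIV. sampled_factor u w p $ i $ k * sampled_factor u w p $ j $ k)" for i j
  proof -
    have "sampled_matrix u w p $ i $ j = (\<Sum>k\<in>UNIV. u (p k) * (w k $ i * w k $ j))"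
      by (simp add: sampled_matrix_def outer_def)
    then show ?thesis unfolding weight by (simp add: sampled_factor_def)
  qed
  then show ?thesis by (simp add: vec_eq_iff matrix_matrix_mult_def transpose_def)
qed

lemma sampled_matrix_swap:
  "sampled_matrix u w p - sampled_matrix u w (swap_perm k l p) = (u (p k) - u (p l)) *\<^sub>R (outer (w k) - outer (w l))"
proof (cases "k = l")
  case True
  have "swap_perm k k p = p" by (auto simp: swap_perm_apply)
  with True show ?thesis by simp
next
  case False
  have "sampled_matrix u w p - sampled_matrix u w (swap_perm k l p)
    = (\<Sum>j\<in>UNIV. (if j = k then (u (p k) - u (p l)) *\<^sub>R outer (w k) else 0)
       + (if j = l then (u (p l) - u (p k)) *\<^sub>R outer (w l) else 0))"
    unfolding sampled_matrix_def sum_subtractf[symmetric]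
    by (intro sum.cong) (use False in \<open>auto simp: swap_perm_apply algebra_simps\<close>)
  also have "\<dots> = (u (p k) - u (p l)) *\<^sub>R outer (w k) + (u (p l) - u (p k)) *\<^sub>R outer (w l)"
    by (simp add: sum.distrib)
  finally show ?thesis by (simp add: algebra_simps)
qed

text \<open>The weighted sum of the rank-one matrices is X itself and raises the exponent; the plain
  sum is a multiple of the identity and keeps it. This is why exchanging produces a recursion
  between moments only.\<close>

lemma sum_trace_outer:
  "(\<Sum>k\<in>UNIV. u (p k) * trace (outer (w k) ** mpow (sampled_matrix u w p) n)) = trace (mpow (sampled_matrix u w p) (Suc n))"
  "(\<Sum>k\<in>UNIV. trace (outer (w k) ** mpow (sampled_matrix u w p) n)) = c * trace (mpow (sampled_matrix u w p) n)"
proof -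
  have "trace (mpow (sampled_matrix u w p) (Suc n)) = trace ((\<Sum>k\<in>UNIV. u (p k) *\<^sub>R outer (w k)) ** mpow (sampled_matrix u w p) n)"
    by (simp add: sampled_matrix_def)
  then show "(\<Sum>k\<in>UNIV. u (p k) * trace (outer (w k) ** mpow (sampled_matrix u w p) n)) = trace (mpow (sampled_matrix u w p) (Suc n))"
    by (simp add: mm.sum_left mm.scaleR_left linear_sum[OF linear_trace] linear_cmul[OF linear_trace])
  have "(\<Sum>k\<in>UNIV. trace (outer (w k) ** mpow (sampled_matrix u w p) n)) = trace ((\<Sum>k\<in>UNIV. outer (w k)) ** mpow (sampled_matrix u w p) n)"
    by (simp add: mm.sum_left linear_sum[OF linear_trace])
  then show "(\<Sum>k\<in>UNIV. trace (outer (w k) ** mpow (sampled_matrix u w p) n)) = c * trace (mpow (sampled_matrix u w p) n)"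
    by (simp add: wsum mm.scaleR_left linear_cmul[OF linear_trace])
qed

text \<open>The matrix form of the exchange identity, obtained by testing each rank-one matrix
  against the n-th power of X. The right side vanishes for n = 0, which fixes the first
  moment.\<close>

lemma trace_moment_exchange:
  "real CARD('d) * trace_moment u w (Suc n) - c * trace_moment u w n
    = (\<Sum>k\<in>UNIV. \<Sum>l\<in>UNIV. \<Sum>p\<in>perms. trace ((sampled_matrix u w p - sampled_matrix u w (swap_perm k l p))
        ** (mpow (sampled_matrix u w p) n - mpow (sampled_matrix u w (swap_perm k l p)) n))) / 4"
proof -
  define h where "h k p = trace (outer (w k) ** mpow (sampled_matrix u w p) n)" for k p
  have "real CARD('d) * trace_moment u w (Suc n) - c * trace_moment u w n
    = real CARD('d) * (\<Sum>p\<in>perms. \<Sum>k\<in>UNIV. u (p k) * h k p) - (\<Sum>p\<in>perms. \<Sum>k\<in>UNIV. h k p)"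
    unfolding h_def sum_trace_outer trace_moment_def by (simp add: sum_distrib_left)
  also have "\<dots> = (\<Sum>k\<in>UNIV. \<Sum>l\<in>UNIV. \<Sum>p\<in>perms.
        (u (p k) - u (p l)) * ((h k p - h l p) - (h k (swap_perm k l p) - h l (swap_perm k l p)))) / 4"
    by (rule perm_exchange[OF usum])
  also have "\<dots> = (\<Sum>k\<in>UNIV. \<Sum>l\<in>UNIV. \<Sum>p\<in>perms. trace ((sampled_matrix u w p - sampled_matrix u w (swap_perm k l p))
        ** (mpow (sampled_matrix u w p) n - mpow (sampled_matrix u w (swap_perm k l p)) n))) / 4"
  proof -
    have "(u (p k) - u (p l)) * ((h k p - h l p) - (h k (swap_perm k l p) - h l (swap_perm k l p)))
      = trace ((sampled_matrix u w p - sampled_matrix u w (swap_perm k l p))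
        ** (mpow (sampled_matrix u w p) n - mpow (sampled_matrix u w (swap_perm k l p)) n))" for k l p
    unfolding h_def sampled_matrix_swap
    by (simp add: mm.scaleR_left mm.diff_left mm.diff_right linear_cmul[OF linear_trace] trace_sub right_diff_distrib)
    then show ?thesis by simp
  qed
  finally show ?thesis .
qed

lemma trace_moment_1: "real CARD('d) * trace_moment u w 1 = c * trace_moment u w 0"
  using trace_moment_exchange[of 0] by (simp add: linear_0[OF linear_trace])

text \<open>The scalar argument of \<open>permutation_sum_tail\<close> inside the trace:
  \<open>trace_mean_value\<close> replaces \<open>exp_trapezoid\<close>, and the squared increments
  are again bounded linearly, in the weights and in the rank-one matrices, so their sum over pairs
  consists of the two lower moments. The factor \<open>Suc n\<close> is the price of differentiating
  a power and limits the usable n to the order of 1 / (M m).\<close>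

lemma trace_moment_step:
  "real CARD('d) * trace_moment u w (Suc (Suc n))
    \<le> c * trace_moment u w (Suc n) + real (Suc n) * M * (real CARD('d) * trace_moment u w (Suc n) + c * trace_moment u w n)"
proof -
  let ?X = "sampled_matrix u w" and ?P = "perms :: ('d \<Rightarrow> 'd) set" and ?d = "real CARD('d)"
  define Z where "Z k l p = ?X p - ?X (swap_perm k l p)" for k l p
  define h where "h k p = trace (outer (w k) ** mpow (?X p) n)" for k p
  have h0: "0 \<le> h k p" for k p
    unfolding h_def trace_outer_mult by (rule gram_mpow_psd[OF sampled_matrix_gram])
  have \<mu>0: "0 \<le> \<mu>" using u0 u1 order_trans by blast
  have "?d * trace_moment u w (Suc (Suc n)) - c * trace_moment u w (Suc n)
    = (\<Sum>k\<in>UNIV. \<Sum>l\<in>UNIV. \<Sum>p\<in>?P. trace (Z k l p ** (mpow (?X p) (Suc n) - mpow (?X (swap_perm k l p)) (Suc n)))) / 4"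
    unfolding Z_def by (rule trace_moment_exchange)
  also have "\<dots> \<le> (\<Sum>k\<in>UNIV. \<Sum>l\<in>UNIV. \<Sum>p\<in>?P. real (Suc n) / 2 *
      trace ((Z k l p ** Z k l p) ** (mpow (?X p) n + mpow (?X (swap_perm k l p)) n))) / 4"
  proof (intro divide_right_mono sum_mono)
    fix k l p
    show "trace (Z k l p ** (mpow (?X p) (Suc n) - mpow (?X (swap_perm k l p)) (Suc n)))
      \<le> real (Suc n) / 2 * trace ((Z k l p ** Z k l p) ** (mpow (?X p) n + mpow (?X (swap_perm k l p)) n))"
      using trace_mean_value[OF sampled_matrix_gram sampled_matrix_gram, of p "swap_perm k l p" n]
      by (simp add: Z_def)
  qed simp
  also have "\<dots> = (\<Sum>k\<in>UNIV. \<Sum>l\<in>UNIV. \<Sum>p\<in>?P. real (Suc n) * trace ((Z k l p ** Z k l p) ** mpow (?X p) n)) / 4"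
  proof -
    have "(\<Sum>p\<in>?P. real (Suc n) / 2 * trace ((Z k l p ** Z k l p) ** (mpow (?X p) n + mpow (?X (swap_perm k l p)) n)))
      = (\<Sum>p\<in>?P. real (Suc n) * trace ((Z k l p ** Z k l p) ** mpow (?X p) n))" for k l
    proof -
      have ZZ: "Z k l (swap_perm k l p) ** Z k l (swap_perm k l p) = Z k l p ** Z k l p" for p
      proof -
        have "Z k l (swap_perm k l p) = - Z k l p" by (simp add: Z_def)
        then show ?thesis by (simp add: mm.minus_left mm.minus_right)
      qed
      show ?thesis
        using sum_perms_swap[of "\<lambda>p. trace ((Z k l p ** Z k l p) ** mpow (?X p) n)" k l]
        by (simp only: ZZ mm.add_right trace_add sum.distrib sum_distrib_left[symmetric]) simp
    qed
    then show ?thesis by simp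
  qed
  also have "\<dots> \<le> (\<Sum>k\<in>UNIV. \<Sum>l\<in>UNIV. \<Sum>p\<in>?P. real (Suc n) * (2 * M * ((u (p k) + u (p l)) * (h k p + h l p)))) / 4"
  proof (intro divide_right_mono sum_mono mult_left_mono)
    fix k l p
    have "trace ((Z k l p ** Z k l p) ** mpow (?X p) n)
      = (u (p k) - u (p l))\<^sup>2 * trace (((outer (w k) - outer (w l)) ** (outer (w k) - outer (w l))) ** mpow (?X p) n)"
      unfolding Z_def sampled_matrix_swap
      by (simp add: mm.scaleR_left mm.scaleR_right linear_cmul[OF linear_trace] power2_eq_square mult.assoc)
    also have "\<dots> \<le> (\<mu> * (u (p k) + u (p l))) * (2 * \<kappa> * (h k p + h l p))"
    proof (intro mult_mono square_diff_le[of u] u0 u1)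
      show "trace (((outer (w k) - outer (w l)) ** (outer (w k) - outer (w l))) ** mpow (?X p) n) \<le> 2 * \<kappa> * (h k p + h l p)"
        unfolding h_def by (rule trace_outer_diff_square_le[OF sampled_matrix_gram w1 w1])
      have "transpose (outer (w k) - outer (w l)) = outer (w k) - outer (w l)"
        by (simp add: outer_def transpose_def vec_eq_iff mult.commute)
      then show "0 \<le> trace (((outer (w k) - outer (w l)) ** (outer (w k) - outer (w l))) ** mpow (?X p) n)"
        using trace_psd_gram_nonneg[OF _ sampled_matrix_gram, of "mat 1" "outer (w k) - outer (w l)" p n] by simp
    qed (simp add: u0 \<mu>0)
    also have "\<dots> = (\<kappa> * \<mu>) * (2 * ((u (p k) + u (p l)) * (h k p + h l p)))" by simp
    also have "\<dots> \<le> M * (2 * ((u (p k) + u (p l)) * (h k p + h l p)))"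
      by (intro mult_right_mono M) (auto simp: u0 h0)
    finally show "trace ((Z k l p ** Z k l p) ** mpow (?X p) n) \<le> 2 * M * ((u (p k) + u (p l)) * (h k p + h l p))"
      by simp
  qed simp_all
  also have "\<dots> = (\<Sum>p\<in>?P. real (Suc n) * M / 2 * (\<Sum>k\<in>UNIV. \<Sum>l\<in>UNIV. (u (p k) + u (p l)) * (h k p + h l p)))"
  proof -
    have "(\<Sum>p\<in>?P. real (Suc n) * M / 2 * (\<Sum>k\<in>UNIV. \<Sum>l\<in>UNIV. (u (p k) + u (p l)) * (h k p + h l p)))
      = (\<Sum>p\<in>?P. \<Sum>k\<in>UNIV. \<Sum>l\<in>UNIV. real (Suc n) * (2 * M * ((u (p k) + u (p l)) * (h k p + h l p))) / 4)"
      unfolding sum_distrib_left by (intro sum.cong refl) simp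
    also have "\<dots> = (\<Sum>k\<in>UNIV. \<Sum>l\<in>UNIV. \<Sum>p\<in>?P. real (Suc n) * (2 * M * ((u (p k) + u (p l)) * (h k p + h l p))) / 4)"
      by (subst sum.swap) (subst (2) sum.swap, rule refl)
    finally show ?thesis by (simp only: sum_divide_distrib)
  qed
  also have "\<dots> = (\<Sum>p\<in>?P. real (Suc n) * M * (?d * trace (mpow (?X p) (Suc n)) + c * trace (mpow (?X p) n)))"
  proof (rule sum.cong[OF refl])
    fix p :: "'d \<Rightarrow> 'd" assume p: "p \<in> ?P"
    have up: "(\<Sum>k\<in>UNIV. u (p k)) = 1" using sum_perms_compose[OF p, of u] usum by simp
    have hu: "(\<Sum>k\<in>UNIV. u (p k) * h k p) = trace (mpow (?X p) (Suc n))"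
      and hs: "(\<Sum>k\<in>UNIV. h k p) = c * trace (mpow (?X p) n)"
      unfolding h_def by (rule sum_trace_outer)+
    have "(\<Sum>l\<in>UNIV. (u (p k) + u (p l)) * (h k p + h l p))
      = ?d * (u (p k) * h k p) + u (p k) * (c * trace (mpow (?X p) n)) + h k p + trace (mpow (?X p) (Suc n))" for k
      by (simp only: distrib_left distrib_right sum.distrib hu hs up sum_distrib_left[symmetric] sum_distrib_right[symmetric] sum_constant) simp
    then have "(\<Sum>k\<in>UNIV. \<Sum>l\<in>UNIV. (u (p k) + u (p l)) * (h k p + h l p))
      = 2 * (?d * trace (mpow (?X p) (Suc n)) + c * trace (mpow (?X p) n))"
      by (simp only: sum.distrib hu hs up sum_distrib_left[symmetric] sum_distrib_right[symmetric] sum_constant) simp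
    then show "real (Suc n) * M / 2 * (\<Sum>k\<in>UNIV. \<Sum>l\<in>UNIV. (u (p k) + u (p l)) * (h k p + h l p))
      = real (Suc n) * M * (?d * trace (mpow (?X p) (Suc n)) + c * trace (mpow (?X p) n))"
      by (simp only:) simp
  qed
  also have "\<dots> = real (Suc n) * M * (?d * trace_moment u w (Suc n) + c * trace_moment u w n)"
    by (simp only: trace_moment_def sum_distrib_left sum.distrib distrib_left)
  finally show ?thesis by simp
qed

text \<open>With moments rescaled by m ^ n / (K m), K the number of permutations, the recursion
  becomes a (n + 2) \<le> (1 + \<delta>) a (n + 1) + \<delta> a n as long as the step factor is at
  most \<delta>. The hypothesis on r says precisely that r ^ n dominates its solutions.\<close>

lemma trace_moment_bound:
  assumes r: "1 \<le> r" and \<delta>: "(1 + \<delta>) * r + \<delta> \<le> r\<^sup>2"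
    and N: "real N * M * real CARD('m) \<le> \<delta>" and "n \<le> Suc N"
  shows "trace_moment u w n \<le> real (card (perms :: ('d \<Rightarrow> 'd) set)) * real CARD('m) * (r / real CARD('m)) ^ n"
  using \<open>n \<le> Suc N\<close>
proof (induction n rule: less_induct)
  case (less n)
  let ?m = "real CARD('m)" and ?d = "real CARD('d)" and ?K = "real (card (perms :: ('d \<Rightarrow> 'd) set)) * real CARD('m)"
  have m0: "0 < ?m" and d0: "0 < ?d" by (simp_all add: card_gt_0_iff)
  have K0: "0 \<le> ?K" by simp
  have T0: "trace_moment u w 0 = ?K" by (simp add: trace_moment_def trace_I)
  have M0: "0 \<le> M"
  proof -
    have "0 \<le> \<kappa>" using w1[of undefined] by (rule order_trans[rotated]) simp
    moreover have "0 \<le> \<mu>" using u0 u1 order_trans by blast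
    ultimately show ?thesis using M by (meson mult_nonneg_nonneg order_trans)
  qed
  have Tnn: "0 \<le> trace_moment u w k" for k
  proof -
    have "0 \<le> trace (mpow (sampled_matrix u w p) k)" for p
      using trace_psd_gram_nonneg[OF _ sampled_matrix_gram, of "mat 1" "mat 1" p k] by simp
    then show ?thesis unfolding trace_moment_def by (intro sum_nonneg)
  qed
  consider "n = 0" | "n = 1" | k where "n = Suc (Suc k)" by (metis One_nat_def not0_implies_Suc)
  then show ?case
  proof cases
    case 1
    then show ?thesis by (simp add: T0)
  next
    case 2
    have "trace_moment u w 1 = ?K / ?m"
      using trace_moment_1 m0 d0 unfolding c T0 by (simp add: field_simps)
    also have "\<dots> \<le> ?K * (r / ?m) ^ 1"
      using mult_left_mono[OF r K0] m0 by (simp add: field_simps)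
    finally show ?thesis using 2 by simp
  next
    case 3
    let ?a = "r / ?m"
    have IH: "trace_moment u w (Suc k) \<le> ?K * ?a ^ Suc k" "trace_moment u w k \<le> ?K * ?a ^ k"
      using less.IH[of "Suc k"] less.IH[of k] less.prems 3 by auto
    have "?d * trace_moment u w n \<le> ?d * ((1 / ?m) * trace_moment u w (Suc k) + (real (Suc k) * M) * (trace_moment u w (Suc k) + trace_moment u w k / ?m))"
      using trace_moment_step[of k] d0 unfolding 3 c by (simp add: field_simps)
    then have "trace_moment u w n \<le> (1 / ?m) * trace_moment u w (Suc k) + (real (Suc k) * M) * (trace_moment u w (Suc k) + trace_moment u w k / ?m)"
      using d0 by (simp only: mult_le_cancel_left_pos)
    also have "\<dots> \<le> (1 / ?m) * trace_moment u w (Suc k) + (\<delta> / ?m) * (trace_moment u w (Suc k) + trace_moment u w k / ?m)"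
    proof (intro add_left_mono mult_right_mono)
      \<comment> \<open>The recursion reaches the exponent k + 2 with the factor
        \<open>Suc k\<close>, so k + 2 \<le> Suc N gives exactly Suc k \<le> N.\<close>
      have "real (Suc k) * (M * ?m) \<le> real N * (M * ?m)"
        using less.prems 3 M0 by (intro mult_right_mono) auto
      with N have "real (Suc k) * M * ?m \<le> \<delta>" by (simp add: mult.assoc)
      then show "real (Suc k) * M \<le> \<delta> / ?m" using m0 by (simp add: pos_le_divide_eq)
    qed (use Tnn m0 in auto)
    also have "\<dots> \<le> (1 / ?m) * (?K * ?a ^ Suc k) + (\<delta> / ?m) * (?K * ?a ^ Suc k + ?K * ?a ^ k / ?m)"
    proof (intro add_mono mult_left_mono divide_right_mono)
      have "0 \<le> real N * M * ?m" using M0 by simp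
      then show "0 \<le> \<delta> / ?m" using N m0 by simp
    qed (use IH m0 in auto)
    also have "\<dots> = ?K * ?a ^ k * ((1 + \<delta>) * r + \<delta>) / ?m\<^sup>2"
      using m0 by (simp add: field_simps power2_eq_square)
    also have "\<dots> \<le> ?K * ?a ^ k * r\<^sup>2 / ?m\<^sup>2"
      using r m0 by (intro divide_right_mono mult_left_mono \<delta>) auto
    also have "\<dots> = ?K * ?a ^ n" by (simp add: 3 power2_eq_square)
    finally show ?thesis .
  qed
qed

text \<open>Markov's inequality for the trace of the power \<open>Suc N\<close>. The extra factor e
  in \<open>L\<close> over the growth rate r / m gains exp (-1) per power; the factor m left in the
  bound is the trace of the identity.\<close>

lemma sampled_matrix_tail:
  assumes "1 \<le> r" "(1 + \<delta>) * r + \<delta> \<le> r\<^sup>2" "real N * M * real CARD('m) \<le> \<delta>"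
    and L: "L = exp 1 * r / real CARD('m)" and q: "q \<le> real (Suc N)"
  shows "real (card {p\<in>perms. \<not> (\<forall>v. v \<bullet> (sampled_matrix u w p *v v) \<le> L * (norm v)\<^sup>2)})
    \<le> real (card (perms :: ('d \<Rightarrow> 'd) set)) * (real CARD('m) * exp (- q))"
    (is "real (card ?A) \<le> _")
proof -
  let ?m = "real CARD('m)" and ?n = "Suc N"
  have m0: "0 < ?m" by (simp add: card_gt_0_iff)
  have L0: "0 < L" unfolding L using m0 assms(1) by simp
  have tr0: "0 \<le> trace (mpow (sampled_matrix u w p) k)" for p k
    using trace_psd_gram_nonneg[OF _ sampled_matrix_gram, of "mat 1" "mat 1" p k] by simp
  have big: "L ^ ?n \<le> trace (mpow (sampled_matrix u w p) ?n)" if p: "p \<in> ?A" for p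
  proof -
    from p obtain v where v: "L * (norm v)\<^sup>2 < v \<bullet> (sampled_matrix u w p *v v)" by (auto simp: not_le)
    then have "v \<noteq> 0" by auto
    define x where "x = (1 / norm v) *\<^sub>R v"
    have "v \<bullet> (sampled_matrix u w p *v v) = (norm v)\<^sup>2 * (x \<bullet> (sampled_matrix u w p *v x))"
      using \<open>v \<noteq> 0\<close> by (simp add: x_def matrix_vector_mult_scaleR power2_eq_square)
    with v have "L * (norm v)\<^sup>2 < (x \<bullet> (sampled_matrix u w p *v x)) * (norm v)\<^sup>2" by (simp add: mult.commute)
    then have "L < x \<bullet> (sampled_matrix u w p *v x)"
      by (rule mult_right_less_imp_less) simp
    then have "L ^ ?n \<le> (x \<bullet> (sampled_matrix u w p *v x)) ^ ?n" using L0 by (intro power_mono) auto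
    also have "\<dots> \<le> trace (mpow (sampled_matrix u w p) ?n)"
      by (rule gram_quadratic_power_le_trace[OF sampled_matrix_gram]) (use \<open>v \<noteq> 0\<close> in \<open>simp add: x_def\<close>)
    finally show ?thesis .
  qed
  have "real (card ?A) * L ^ ?n = (\<Sum>p\<in>?A. L ^ ?n)" by simp
  also have "\<dots> \<le> (\<Sum>p\<in>?A. trace (mpow (sampled_matrix u w p) ?n))" by (intro sum_mono big)
  also have "\<dots> \<le> trace_moment u w ?n"
    unfolding trace_moment_def by (intro sum_mono2) (auto simp: finite_permutes_UNIV tr0 simp del: mpow.simps)
  also have "\<dots> \<le> real (card (perms :: ('d \<Rightarrow> 'd) set)) * ?m * (r / ?m) ^ ?n"
    by (rule trace_moment_bound[of r \<delta> N]) (use assms in auto)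
  also have "(r / ?m) ^ ?n = exp (- real ?n) * L ^ ?n"
  proof -
    have "exp (- real ?n) * exp 1 ^ ?n = 1"
      by (simp only: exp_of_nat_mult[symmetric] exp_add[symmetric]) simp
    moreover have "L ^ ?n = exp 1 ^ ?n * (r / ?m) ^ ?n"
      unfolding L by (simp only: times_divide_eq_right[symmetric] power_mult_distrib)
    ultimately show ?thesis by (metis mult.assoc mult_1)
  qed
  also have "real (card (perms :: ('d \<Rightarrow> 'd) set)) * ?m * (exp (- real ?n) * L ^ ?n)
    \<le> real (card (perms :: ('d \<Rightarrow> 'd) set)) * ?m * (exp (- q) * L ^ ?n)"
    using q L0 by (intro mult_left_mono mult_right_mono) auto
  finally have "real (card ?A) * L ^ ?n \<le> (real (card (perms :: ('d \<Rightarrow> 'd) set)) * (?m * exp (- q))) * L ^ ?n"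
    by (simp only: mult.assoc)
  then show ?thesis using L0 by (simp only: mult_le_cancel_right_pos zero_less_power)
qed

end

subsection \<open>Nets in unit spheres\<close>

definition quarter_separated :: "'a::real_normed_vector set \<Rightarrow> bool" where
  "quarter_separated F \<longleftrightarrow> (\<forall>x\<in>F. \<forall>y\<in>F. x \<noteq> y \<longrightarrow> 1 / 4 \<le> dist x y)"

text \<open>
  Volume comparison of the disjoint cylinders of radius \<open>1 / 8\<close> around the points of \<open>F\<close> with the cylinder
  of radius \<open>9 / 8\<close>; the factor \<open>9\<close> is applied to the coordinates in \<open>J\<close> only.
\<close>
lemma quarter_separated_card_coordinate:
  fixes F :: "(real ^ 'd) set" and J :: "'d set"
  assumes fin: "finite F" and sep: "quarter_separated F" and norm1: "\<And>x. x \<in> F \<Longrightarrow> norm x = 1"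
    and supp: "\<And>x i. x \<in> F \<Longrightarrow> i \<notin> J \<Longrightarrow> x $ i = 0"
  shows "card F \<le> 9 ^ card J"
proof -
  define \<pi> where "\<pi> x = (\<chi> i. if i \<in> J then x $ i else 0)" for x :: "real ^ 'd"
  \<comment> \<open>A ball in the coordinates of \<open>J\<close> times a cube in the others: this
    keeps the sets open and of positive measure in the full space, so Lebesgue measure there
    suffices. Translations by points of \<open>F\<close> do not move the cube factor.\<close>
  define C where "C r = {x. norm (\<pi> x) < r \<and> (\<forall>i\<in>-J. \<bar>x $ i\<bar> < 1)}" for r
  have lin: "\<pi> (x + y) = \<pi> x + \<pi> y" "\<pi> (x - y) = \<pi> x - \<pi> y" "\<pi> (c *\<^sub>R x) = c *\<^sub>R \<pi> x" for x y c
    by (auto simp: \<pi>_def vec_eq_iff)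
  have "linear \<pi>" by (intro linearI lin)
  then have "continuous_on UNIV \<pi>" by (simp add: linear_continuous_on linear_conv_bounded_linear)
  then have "open (C r)" for r
  proof -
    have "open {x. norm (\<pi> x) < r}"
      using \<open>continuous_on UNIV \<pi>\<close> by (intro open_Collect_less continuous_intros)
    moreover have "open (\<Inter>i\<in>-J. {x :: real ^ 'd. \<bar>x $ i\<bar> < 1})"
      by (intro open_INT ballI open_Collect_less continuous_intros) auto
    moreover have "C r = {x. norm (\<pi> x) < r} \<inter> (\<Inter>i\<in>-J. {x. \<bar>x $ i\<bar> < 1})"
      by (auto simp: C_def)
    ultimately show ?thesis by auto
  qed
  moreover have "bounded (C r)" for r
  proof -
    have "\<bar>x $ i\<bar> \<le> max r 1" if "x \<in> C r" for x i
    proof (cases "i \<in> J")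
      case True
      then have "\<bar>x $ i\<bar> = \<bar>\<pi> x $ i\<bar>" by (simp add: \<pi>_def)
      also have "\<dots> \<le> norm (\<pi> x)" by (rule component_le_norm_cart)
      also have "\<dots> < r" using that by (simp add: C_def)
      finally show ?thesis by simp
    next
      case False
      then have "\<bar>x $ i\<bar> < 1" using that by (simp add: C_def)
      then show ?thesis by simp
    qed
    then have "norm x \<le> (\<Sum>i\<in>(UNIV :: 'd set). max r 1)" if "x \<in> C r" for x
      by (intro order_trans[OF norm_le_l1_cart] sum_mono) (use that in auto)
    then show ?thesis by (auto simp: bounded_iff)
  qed
  ultimately have meas: "C r \<in> lmeasurable" for r by (intro lmeasurable_open)
  have pos: "0 < measure lebesgue (C (1 / 8))"
  proof -
    have "\<pi> 0 = 0" by (simp add: \<pi>_def vec_eq_iff)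
    then have "0 \<in> C (1 / 8)" by (simp add: C_def)
    then have "\<not> negligible (C (1 / 8))"
      using \<open>open (C (1 / 8))\<close> by (intro open_not_negligible) auto
    then show ?thesis using meas[of "1 / 8"] by (simp add: negligible_iff_measure0 less_le)
  qed
  have big: "measure lebesgue (C (9 / 8)) = 9 ^ card J * measure lebesgue (C (1 / 8))"
  proof -
    define k where "k i = (if i \<in> J then 9 else 1 :: real)" for i
    have k0: "k i \<noteq> 0" for i by (simp add: k_def)
    have "C (9 / 8) = (\<lambda>x. \<chi> i. k i * x $ i) ` C (1 / 8)"
    proof -
      have scale: "(\<chi> i. k i * x $ i) \<in> C (9 * r) \<longleftrightarrow> x \<in> C r" for x r
      proof -
        have "\<pi> (\<chi> i. k i * x $ i) = 9 *\<^sub>R \<pi> x" by (simp add: \<pi>_def k_def vec_eq_iff)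
        then show ?thesis by (auto simp: C_def k_def)
      qed
      show ?thesis
      proof (intro equalityI subsetI)
        fix x assume x: "x \<in> C (9 / 8)"
        define z where "z = (\<chi> i. x $ i / k i)"
        have "x = (\<chi> i. k i * z $ i)" using k0 by (simp add: z_def vec_eq_iff)
        with x scale[of z "1 / 8"] show "x \<in> (\<lambda>x. \<chi> i. k i * x $ i) ` C (1 / 8)" by auto
      qed (use scale[of _ "1 / 8"] in auto)
    qed
    moreover have "prod k UNIV = 9 ^ card J"
      by (simp add: k_def prod.If_cases)
    ultimately show ?thesis using measure_stretch[OF meas, of k "1 / 8"] by simp
  qed
  have shift: "(+) x ` C r = {y. y - x \<in> C r}" for x r
    by (force simp: image_iff)
  have "real (card F) * measure lebesgue (C (1 / 8)) = (\<Sum>x\<in>F. measure lebesgue ((+) x ` C (1 / 8)))"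
    by (simp add: measure_translation)
  also have "\<dots> = measure lebesgue (\<Union>x\<in>F. (+) x ` C (1 / 8))"
  proof (rule measure_negligible_finite_Union_image[OF fin, symmetric])
    show "(+) x ` C (1 / 8) \<in> lmeasurable" for x by (rule measurable_translation[OF meas])
    show "pairwise (\<lambda>x y. negligible ((+) x ` C (1 / 8) \<inter> (+) y ` C (1 / 8))) F"
    proof (rule pairwiseI)
      fix x y assume xy: "x \<in> F" "y \<in> F" "x \<noteq> y"
      have "\<pi> x = x" "\<pi> y = y" using supp xy by (auto simp: \<pi>_def vec_eq_iff)
      have False if z: "z - x \<in> C (1 / 8)" "z - y \<in> C (1 / 8)" for z
      proof -
        have "norm (\<pi> z - x) < 1 / 8" "norm (\<pi> z - y) < 1 / 8"
          using z \<open>\<pi> x = x\<close> \<open>\<pi> y = y\<close> by (auto simp: C_def lin)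
        then have "dist x y < 1 / 4"
          using dist_triangle_half_l[of x "\<pi> z" "1 / 4" y] by (simp add: dist_norm norm_minus_commute)
        then show False using sep xy by (force simp: quarter_separated_def)
      qed
      then have "(+) x ` C (1 / 8) \<inter> (+) y ` C (1 / 8) = {}" unfolding shift by auto
      then show "negligible ((+) x ` C (1 / 8) \<inter> (+) y ` C (1 / 8))" by simp
    qed
  qed
  also have "\<dots> \<le> measure lebesgue (C (9 / 8))"
  proof (rule measure_mono_fmeasurable)
    show "(\<Union>x\<in>F. (+) x ` C (1 / 8)) \<subseteq> C (9 / 8)"
    proof
      fix z assume "z \<in> (\<Union>x\<in>F. (+) x ` C (1 / 8))"
      then obtain x where x: "x \<in> F" and z: "z - x \<in> C (1 / 8)" unfolding shift by auto
      have "\<pi> x = x" using supp x by (auto simp: \<pi>_def vec_eq_iff)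
      then have "norm (\<pi> z - x) < 1 / 8" using z by (simp add: C_def lin)
      then have "norm (\<pi> z) < 9 / 8" using norm1[OF x] norm_triangle_sub[of "\<pi> z" x] by simp
      moreover have "\<forall>i\<in>-J. \<bar>z $ i\<bar> < 1" using z supp[OF x] by (auto simp: C_def)
      ultimately show "z \<in> C (9 / 8)" by (simp add: C_def)
    qed
    show "(\<Union>x\<in>F. (+) x ` C (1 / 8)) \<in> sets lebesgue"
      using fin measurable_translation[OF meas] by (intro sets.finite_UN) (auto simp: fmeasurableD)
  qed (rule meas)
  also have "\<dots> = 9 ^ card J * measure lebesgue (C (1 / 8))" by (rule big)
  finally have "real (card F) \<le> 9 ^ card J" using pos by (simp only: mult_le_cancel_right_pos)
  then show ?thesis by (metis of_nat_le_iff of_nat_numeral of_nat_power)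
qed

text \<open>A linear isometry carries \<open>E\<close> onto a coordinate subspace of the same
  dimension, where the volume comparison is available; it preserves separation and the unit
  sphere.\<close>

lemma quarter_separated_card:
  fixes E :: "(real ^ 'd) set"
  assumes E: "subspace E" and fin: "finite F" and sep: "quarter_separated F" and sub: "F \<subseteq> E \<inter> sphere 0 1"
  shows "card F \<le> 9 ^ dim E"
proof -
  have "dim E \<le> CARD('d)" by (rule dim_subset_UNIV_cart)
  then obtain J :: "'d set" where J: "card J = dim E"
    using obtain_subset_with_card_n[of "dim E" "UNIV :: 'd set"] by blast
  define T where "T = {x :: real ^ 'd. \<forall>i. i \<notin> J \<longrightarrow> x $ i = 0}"
  have "subspace T" by (auto simp: T_def subspace_def)
  moreover have "dim E = dim T"
    using dim_substandard_cart[of J, where 'a = real] J by (simp add: T_def dim_vec_eq)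
  ultimately obtain f where f: "linear f" "f ` E = T" "\<And>x. x \<in> E \<Longrightarrow> norm (f x) = norm x"
    by (metis isometries_subspaces[OF E])
  have dist: "dist (f x) (f y) = dist x y" if "x \<in> F" "y \<in> F" for x y
  proof -
    have "x - y \<in> E" using that sub E by (auto intro: subspace_diff)
    then show ?thesis by (simp add: dist_norm flip: f(3) linear_diff[OF f(1)])
  qed
  have "inj_on f F" by (rule inj_onI) (metis dist dist_eq_0_iff)
  then have "card F = card (f ` F)" by (simp add: card_image)
  also have "\<dots> \<le> 9 ^ card J"
  proof (rule quarter_separated_card_coordinate)
    show "quarter_separated (f ` F)" using sep dist by (auto simp: quarter_separated_def)
    show "norm x = 1" if "x \<in> f ` F" for x using that f(3) sub by force
    show "x $ i = 0" if "x \<in> f ` F" "i \<notin> J" for x i using that f(2) sub by (auto simp: T_def)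
  qed (use fin in simp)
  finally show ?thesis by (simp add: J)
qed

text \<open>A separated set of largest cardinality is a net, since a point far from all of it could
  be added. The volume bound ensures that a largest one exists and also counts it.\<close>

lemma subspace_sphere_net:
  fixes E :: "(real ^ 'd) set"
  assumes E: "subspace E"
  obtains N where "finite N" "N \<subseteq> E \<inter> sphere 0 1" "card N \<le> 9 ^ dim E"
    "\<And>x. x \<in> E \<inter> sphere 0 1 \<Longrightarrow> \<exists>y\<in>N. dist x y \<le> 1 / 4"
proof -
  define P where "P F \<longleftrightarrow> finite F \<and> F \<subseteq> E \<inter> sphere 0 1 \<and> quarter_separated F" for F
  have "P {}" by (simp add: P_def quarter_separated_def)
  moreover have "\<forall>F. P F \<longrightarrow> card F \<le> 9 ^ dim E"
    using quarter_separated_card[OF E] by (auto simp: P_def)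
  ultimately obtain N where N: "P N" and max: "\<And>F. P F \<Longrightarrow> card F \<le> card N"
    using ex_has_greatest_nat[of P "{}" card "Suc (9 ^ dim E)"] by (metis le_imp_less_Suc)
  have "\<exists>y\<in>N. dist x y \<le> 1 / 4" if x: "x \<in> E \<inter> sphere 0 1" for x
  proof (rule ccontr)
    assume "\<not> ?thesis"
    then have far: "\<And>y. y \<in> N \<Longrightarrow> 1 / 4 < dist x y" by force
    then have "x \<notin> N" by fastforce
    have "P (insert x N)"
      using N x far unfolding P_def quarter_separated_def
      by (auto simp: dist_commute less_imp_le)
    then have "card (insert x N) \<le> card N" by (rule max)
    then show False using N \<open>x \<notin> N\<close> by (simp add: P_def)
  qed
  then show ?thesis using that[of N] N quarter_separated_card[OF E] by (auto simp: P_def)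
qed

text \<open>Let \<sigma> be the supremum of the deviation on the unit sphere of \<open>E\<close>. By
  polarization the symmetric form \<open>b\<close> is bounded by \<sigma> as a bilinear form, and
  moving from a point to the net costs at most \<sigma> * (1 / 4) * 2. So \<sigma> \<le> \<epsilon>
  / 2 + \<sigma> / 2, which gives \<sigma> \<le> \<epsilon>.\<close>

lemma net_extension:
  fixes E :: "(real ^ 'd) set" and R :: "real ^ 'd ^ 'm"
  assumes E: "subspace E" and N: "N \<subseteq> E \<inter> sphere 0 1"
    and net: "\<And>x. x \<in> E \<inter> sphere 0 1 \<Longrightarrow> \<exists>y\<in>N. dist x y \<le> 1 / 4"
    and bound: "\<And>y. y \<in> N \<Longrightarrow> \<bar>(norm (R *v y))\<^sup>2 - 1\<bar> \<le> \<epsilon> / 2"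
    and x: "x \<in> E"
  shows "\<bar>(norm (R *v x))\<^sup>2 - (norm x)\<^sup>2\<bar> \<le> \<epsilon> * (norm x)\<^sup>2"
proof (cases "x = 0")
  case False
  define b where "b v w = (R *v v) \<bullet> (R *v w) - v \<bullet> w" for v w
  define S where "S = E \<inter> sphere 0 1"
  have bq: "b v v = (norm (R *v v))\<^sup>2 - (norm v)\<^sup>2" for v
    by (simp add: b_def power2_norm_eq_inner)
  have unit: "(1 / norm v) *\<^sub>R v \<in> S" if "v \<in> E" "v \<noteq> 0" for v
    using that E by (simp add: S_def subspace_scale)
  have bscale: "b (s *\<^sub>R v) (t *\<^sub>R w) = s * t * b v w" for s t v w
    by (simp add: b_def matrix_vector_mult_scaleR algebra_simps)
  define \<sigma> where "\<sigma> = (SUP v\<in>S. \<bar>b v v\<bar>)"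
  \<comment> \<open>Boundedness makes the supremum an actual upper bound, which
    \<open>cSUP_upper\<close> asks for.\<close>
  have bdd: "bdd_above ((\<lambda>v. \<bar>b v v\<bar>) ` S)"
  proof (rule bdd_aboveI2)
    fix v assume "v \<in> S"
    then have v1: "norm v = 1" by (simp add: S_def)
    have "norm (R *v v) \<le> onorm ((*v) R)"
      using onorm[OF matrix_vector_mul_bounded_linear, of R v] v1 by simp
    then have "(norm (R *v v))\<^sup>2 \<le> (onorm ((*v) R))\<^sup>2" by (intro power_mono) auto
    then show "\<bar>b v v\<bar> \<le> (onorm ((*v) R))\<^sup>2 + 1"
      using v1 zero_le_power2[of "norm (R *v v)"] unfolding bq abs_le_iff by simp
  qed
  have quad: "\<bar>b v v\<bar> \<le> \<sigma> * (norm v)\<^sup>2" if "v \<in> E" for v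
  proof (cases "v = 0")
    case False
    have "\<bar>b ((1 / norm v) *\<^sub>R v) ((1 / norm v) *\<^sub>R v)\<bar> \<le> \<sigma>"
      unfolding \<sigma>_def by (rule cSUP_upper[OF unit[OF that False] bdd])
    then show ?thesis using False by (simp add: bscale abs_mult field_simps power2_eq_square)
  qed (simp add: b_def)
  have bil: "\<bar>b v w\<bar> \<le> \<sigma> * norm v * norm w" if vw: "v \<in> E" "w \<in> E" for v w
  proof (cases "v = 0 \<or> w = 0")
    case False
    define p q where "p = (1 / norm v) *\<^sub>R v" and "q = (1 / norm w) *\<^sub>R w"
    have pq: "p \<in> E" "q \<in> E" "norm p = 1" "norm q = 1"
      using unit vw False by (auto simp: p_def q_def S_def)
    have "4 * b p q = b (p + q) (p + q) - b (p - q) (p - q)"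
      by (simp add: b_def matrix_vector_right_distrib matrix_vector_mult_diff_distrib inner_add_left inner_add_right
          inner_diff_left inner_diff_right inner_commute)
    then have "4 * \<bar>b p q\<bar> \<le> \<bar>b (p + q) (p + q)\<bar> + \<bar>b (p - q) (p - q)\<bar>" by linarith
    also have "\<dots> \<le> \<sigma> * (norm (p + q))\<^sup>2 + \<sigma> * (norm (p - q))\<^sup>2"
      using pq E by (intro add_mono quad subspace_add subspace_diff)
    also have "\<dots> = \<sigma> * (2 * (norm p)\<^sup>2 + 2 * (norm q)\<^sup>2)"
      by (simp add: power2_norm_eq_inner inner_add_left inner_add_right inner_diff_left inner_diff_right algebra_simps inner_commute)
    finally have "\<bar>b p q\<bar> \<le> \<sigma>" using pq by simp
    then show ?thesis using False by (simp add: p_def q_def bscale abs_mult field_simps)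
  qed (auto simp: b_def)
  have "\<sigma> \<le> \<epsilon> / 2 + \<sigma> / 2" unfolding \<sigma>_def
  proof (rule cSUP_least)
    show "S \<noteq> {}" using unit[OF x False] by auto
    fix v assume v: "v \<in> S"
    then obtain y where y: "y \<in> N" "dist v y \<le> 1 / 4" using net by (auto simp: S_def)
    have vy: "v \<in> E" "y \<in> E" "norm v = 1" "norm y = 1" using v y N by (auto simp: S_def)
    \<comment> \<open>The difference of squares for a symmetric form: unlike b (v - y) v + b y (v -
      y), it keeps the error in a single term.\<close>
    have "b v v = b y y + b (v - y) (v + y)"
      by (simp add: b_def matrix_vector_right_distrib matrix_vector_mult_diff_distrib inner_add_right inner_add_left
          inner_diff_left inner_diff_right inner_commute)
    then have "\<bar>b v v\<bar> \<le> \<bar>b y y\<bar> + \<bar>b (v - y) (v + y)\<bar>" by linarith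
    also have "\<dots> \<le> \<epsilon> / 2 + \<sigma> * norm (v - y) * norm (v + y)"
      using vy E bound[OF y(1)] by (intro add_mono bil subspace_add subspace_diff) (auto simp: bq)
    also have "\<dots> \<le> \<epsilon> / 2 + \<sigma> * (1 / 4) * 2"
    proof -
      have "0 \<le> \<sigma>" using quad[OF vy(1)] vy by (simp add: order_trans[OF abs_ge_zero])
      moreover have "norm (v + y) \<le> 2" using norm_triangle_ineq[of v y] vy by simp
      ultimately show ?thesis using y(2) by (intro add_left_mono mult_mono) (auto simp: dist_norm)
    qed
    finally show "\<bar>b v v\<bar> \<le> \<epsilon> / 2 + (SUP v\<in>S. \<bar>b v v\<bar>) / 2" by (simp add: \<sigma>_def)
  qed
  then have "\<sigma> \<le> \<epsilon>" by simp
  then have "\<sigma> * (norm x)\<^sup>2 \<le> \<epsilon> * (norm x)\<^sup>2" by (intro mult_right_mono) auto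
  then show ?thesis using quad[OF x] by (simp add: bq)
qed simp

subsection \<open>The random map at a single vector\<close>

text \<open>Fubini, used with its mirror image below to reveal the random objects one at a time: a
  bound uniform in the part already revealed becomes a bound for the joint law.\<close>

lemma prob_pair_pmf_le_snd:
  assumes "\<And>x. x \<in> set_pmf p \<Longrightarrow> measure_pmf.prob q {y. P x y} \<le> \<delta>" and "0 \<le> \<delta>"
  shows "measure_pmf.prob (pair_pmf p q) {(x, y). P x y} \<le> \<delta>"
proof -
  have "emeasure (measure_pmf (pair_pmf p q)) {(x, y). P x y}
    = (\<integral>\<^sup>+ z. indicator {(x, y). P x y} z \<partial>measure_pmf (pair_pmf p q))"
    by simp
  also have "\<dots> = (\<integral>\<^sup>+ x. \<integral>\<^sup>+ y. indicator {y. P x y} y \<partial>measure_pmf q \<partial>measure_pmf p)"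
    unfolding nn_integral_pair_pmf' by (simp add: indicator_def)
  also have "\<dots> = (\<integral>\<^sup>+ x. emeasure (measure_pmf q) {y. P x y} \<partial>measure_pmf p)"
    by simp
  also have "\<dots> \<le> (\<integral>\<^sup>+ x. ennreal \<delta> \<partial>measure_pmf p)"
    by (intro nn_integral_mono_AE AE_pmfI)
      (use assms in \<open>auto simp: measure_pmf.emeasure_eq_measure intro: ennreal_leI\<close>)
  also have "\<dots> = ennreal \<delta>" by simp
  finally show ?thesis using assms(2) by (simp add: measure_pmf.emeasure_eq_measure)
qed

lemma prob_pair_pmf_le_fst:
  assumes "\<And>y. y \<in> set_pmf q \<Longrightarrow> measure_pmf.prob p {x. P x y} \<le> \<delta>" and "0 \<le> \<delta>"
  shows "measure_pmf.prob (pair_pmf p q) {(x, y). P x y} \<le> \<delta>"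
proof -
  have "measure_pmf.prob (pair_pmf p q) {(x, y). P x y} = measure_pmf.prob (pair_pmf q p) {(y, x). P x y}"
    by (subst pair_commute_pmf) (auto simp: intro!: arg_cong[where f = "measure_pmf.prob _"])
  also have "\<dots> \<le> \<delta>" by (rule prob_pair_pmf_le_snd) (use assms in auto)
  finally show ?thesis .
qed

lemma prob_pmf_of_set_le:
  assumes "finite \<Omega>" "\<Omega> \<noteq> {}" "real (card {x\<in>\<Omega>. P x}) \<le> c * real (card \<Omega>)"
  shows "measure_pmf.prob (pmf_of_set \<Omega>) {x. P x} \<le> c"
proof -
  have "\<Omega> \<inter> {x. P x} = {x\<in>\<Omega>. P x}" by auto
  moreover have "0 < real (card \<Omega>)" using assms by (simp add: card_gt_0_iff)
  ultimately show ?thesis using assms by (simp add: measure_pmf_of_set field_simps)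
qed

text \<open>Hoeffding for each coordinate and each sign: 2 d events, each of probability at most exp
  (- a) / d. The summand \<open>ln d\<close> in the threshold pays for the number of
  coordinates.\<close>

lemma coordinate_tail:
  fixes B :: "real ^ 'd ^ 'd" and x :: "real ^ 'd"
  assumes v: "\<And>k. (\<Sum>j\<in>UNIV. (B $ k $ j)\<^sup>2 * (x $ j)\<^sup>2) \<le> v" and v0: "0 < v" and a: "0 \<le> a"
  shows "real (card {\<xi>\<in>sign_vectors. \<exists>k. 2 * v * (a + ln (real CARD('d))) < ((B *v (diag_matrix \<xi> *v x)) $ k)\<^sup>2})
    \<le> 2 * exp (- a) * real (card (sign_vectors :: (real ^ 'd) set))"
proof -
  let ?S = "sign_vectors :: (real ^ 'd) set" and ?d = "real CARD('d)"
  define r where "r = sqrt (2 * v * (a + ln ?d))"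
  have d1: "1 \<le> ?d" by (simp add: Suc_le_eq card_gt_0_iff)
  then have nn: "0 \<le> 2 * v * (a + ln ?d)" using v0 a by simp
  then have r2: "r\<^sup>2 = 2 * v * (a + ln ?d)" and r0: "0 \<le> r" by (simp_all add: r_def)
  define T where "T k \<sigma> = {\<xi>\<in>?S. r \<le> (\<Sum>j\<in>UNIV. \<sigma> * (B $ k $ j * x $ j) * \<xi> $ j)}" for k and \<sigma> :: real
  have T: "real (card (T k \<sigma>)) \<le> real (card ?S) * (exp (- a) / ?d)" if "\<sigma> = 1 \<or> \<sigma> = -1" for k \<sigma>
  proof -
    have "(\<Sum>j\<in>UNIV. (\<sigma> * (B $ k $ j * x $ j))\<^sup>2) \<le> v"
      using v[of k] that by (auto simp: power_mult_distrib)
    from rademacher_sum_tail[OF this v0 r0]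
    have "real (card (T k \<sigma>)) \<le> real (card ?S) * exp (- (r\<^sup>2 / (2 * v)))" unfolding T_def .
    also have "r\<^sup>2 / (2 * v) = a + ln ?d" using v0 by (simp add: r2)
    also have "exp (- (a + ln ?d)) = exp (- a) / ?d" using d1 by (simp add: exp_diff)
    finally show ?thesis .
  qed
  have fin: "finite (T k \<sigma>)" for k \<sigma> unfolding T_def by (simp add: finite_sign_vectors)
  have "{\<xi>\<in>?S. \<exists>k. 2 * v * (a + ln ?d) < ((B *v (diag_matrix \<xi> *v x)) $ k)\<^sup>2} \<subseteq> (\<Union>k. T k 1 \<union> T k (- 1))"
  proof
    fix \<xi> assume "\<xi> \<in> {\<xi>\<in>?S. \<exists>k. 2 * v * (a + ln ?d) < ((B *v (diag_matrix \<xi> *v x)) $ k)\<^sup>2}"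
    then obtain k where \<xi>: "\<xi> \<in> ?S" and "r\<^sup>2 < ((B *v (diag_matrix \<xi> *v x)) $ k)\<^sup>2" by (auto simp: r2)
    then have "r \<le> \<bar>(B *v (diag_matrix \<xi> *v x)) $ k\<bar>" using r0 abs_le_square_iff[of r "(B *v (diag_matrix \<xi> *v x)) $ k"] by simp
    also have "(B *v (diag_matrix \<xi> *v x)) $ k = (\<Sum>j\<in>UNIV. B $ k $ j * x $ j * \<xi> $ j)"
      by (simp add: matrix_vector_mult_def[of B] diag_matrix_mult_vec mult_ac)
    finally have "\<xi> \<in> T k 1 \<or> \<xi> \<in> T k (- 1)" using \<xi> by (auto simp: T_def abs_if sum_negf split: if_splits)
    then show "\<xi> \<in> (\<Union>k. T k 1 \<union> T k (- 1))" by blast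
  qed
  then have "card {\<xi>\<in>?S. \<exists>k. 2 * v * (a + ln ?d) < ((B *v (diag_matrix \<xi> *v x)) $ k)\<^sup>2} \<le> card (\<Union>k. T k 1 \<union> T k (- 1))"
    by (intro card_mono) (auto simp: fin)
  also have "\<dots> \<le> (\<Sum>k\<in>UNIV. card (T k 1 \<union> T k (- 1)))" by (rule card_UN_le) simp
  also have "\<dots> \<le> (\<Sum>k\<in>UNIV. card (T k 1) + card (T k (- 1)))" by (intro sum_mono card_Un_le)
  finally have "real (card {\<xi>\<in>?S. \<exists>k. 2 * v * (a + ln ?d) < ((B *v (diag_matrix \<xi> *v x)) $ k)\<^sup>2})
    \<le> real (\<Sum>k\<in>UNIV. card (T k 1) + card (T k (- 1)))"
    by (rule of_nat_mono)
  also have "\<dots> = (\<Sum>k\<in>UNIV. real (card (T k 1)) + real (card (T k (- 1))))" by simp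
  also have "\<dots> \<le> (\<Sum>k\<in>(UNIV :: 'd set). real (card ?S) * (exp (- a) / ?d) + real (card ?S) * (exp (- a) / ?d))"
    by (intro sum_mono add_mono T) auto
  also have "\<dots> = 2 * exp (- a) * real (card ?S)" using d1 by simp
  finally show ?thesis .
qed

text \<open>The 3 is one failure for the norm of the sampled matrix and two for the upper and lower
  tails of its trace. Choosing q = a + ln m cancels the factor m of
  \<open>sampled_matrix_tail\<close>.\<close>

lemma sampling_tail:
  fixes u :: "'d::finite \<Rightarrow> real" and w :: "'d \<Rightarrow> real ^ 'm::finite"
  assumes u0: "\<And>k. 0 \<le> u k" and u1: "\<And>k. u k \<le> \<mu>" and usum: "(\<Sum>k\<in>UNIV. u k) = 1"
    and w1: "\<And>k. (norm (w k))\<^sup>2 \<le> \<kappa>"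
    and wsum: "(\<Sum>k\<in>UNIV. outer (w k)) = (real CARD('d) / real CARD('m)) *\<^sub>R mat 1"
    and M: "\<kappa> * \<mu> \<le> 1 / (18 * real CARD('m) * (a + ln (real CARD('m))))"
    and a: "1 \<le> a" and eps: "0 < \<epsilon>" "\<epsilon> < 1" and m: "2025 * a \<le> \<epsilon>\<^sup>2 * real CARD('m)"
  shows "real (card {p\<in>perms. \<not> ((\<forall>v. v \<bullet> (sampled_matrix u w p *v v) \<le> 10 / (3 * real CARD('m)) * (norm v)\<^sup>2)
      \<and> \<bar>(\<Sum>k\<in>UNIV. u (p k) * (norm (w k))\<^sup>2) - 1\<bar> < \<epsilon> / 4)})
    \<le> 3 * exp (- a) * real (card (perms :: ('d \<Rightarrow> 'd) set))"
proof -
  let ?P = "perms :: ('d \<Rightarrow> 'd) set" and ?m = "real CARD('m)" and ?d = "real CARD('d)"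
  define q where "q = a + ln ?m"
  define M' where "M' = 1 / (18 * ?m * q)"
  have m1: "1 \<le> ?m" by (simp add: Suc_le_eq card_gt_0_iff)
  then have q: "1 \<le> q" "a \<le> q" unfolding q_def using a ln_ge_zero[of ?m] by linarith+
  have M'0: "0 < M'" using m1 q by (simp add: M'_def)
  have M: "\<kappa> * \<mu> \<le> M'" using M by (simp add: M'_def q_def)
  define BX where "BX = {p\<in>?P. \<not> (\<forall>v. v \<bullet> (sampled_matrix u w p *v v) \<le> exp 1 * (10 / 9) / ?m * (norm v)\<^sup>2)}"
  define BT where "BT = {p\<in>?P. \<epsilon> / 4 \<le> \<bar>(\<Sum>k\<in>UNIV. u (p k) * (norm (w k))\<^sup>2) - 1\<bar>}"
  have "real (card BX) \<le> real (card ?P) * (?m * exp (- q))"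
    unfolding BX_def
  proof (rule sampled_matrix_tail[OF u0 u1 usum w1 wsum refl M, where r = "10 / 9" and N = "nat \<lfloor>q\<rfloor>" and \<delta> = "1 / 18"])
    \<comment> \<open>With \<delta> = 1 / 18 and r = 10 / 9 the growth condition reads 398 / 324
      \<le> 400 / 324, and e \<le> 3 turns e * r into 10 / 3. Rounding q down keeps N M' m \<le>
      \<delta>, while the power N + 1 still exceeds q.\<close>
    have N: "real (nat \<lfloor>q\<rfloor>) \<le> q" using q by (simp add: of_nat_nat)
    then have "real (nat \<lfloor>q\<rfloor>) * (M' * ?m) \<le> q * (M' * ?m)" using M'0 m1 by (intro mult_right_mono) auto
    also have "\<dots> = 1 / 18" using m1 q by (simp add: M'_def)
    finally show "real (nat \<lfloor>q\<rfloor>) * M' * ?m \<le> 1 / 18" by (simp add: mult.assoc)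
    show "q \<le> real (Suc (nat \<lfloor>q\<rfloor>))" using q by linarith
  qed (simp_all add: power2_eq_square)
  also have "?m * exp (- q) = exp (- a)" using m1 by (simp add: q_def exp_diff)
  finally have BX: "real (card BX) \<le> real (card ?P) * exp (- a)" .
  have BT: "real (card BT) \<le> 2 * real (card ?P) * exp (- a)"
    unfolding BT_def
  proof (rule permutation_sum_tail[OF u0 u1 usum _ w1 _ M, where \<theta> = "\<epsilon> / (5 * M')"])
    have "(\<Sum>k\<in>UNIV. (norm (w k))\<^sup>2) = trace (\<Sum>k\<in>UNIV. outer (w k))"
      unfolding linear_sum[OF linear_trace]
      by (simp add: trace_def outer_def power2_norm_eq_inner inner_vec_def)
    also have "\<dots> = ?d" using m1 by (simp add: wsum linear_cmul[OF linear_trace] trace_I)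
    finally show "(\<Sum>k\<in>UNIV. (norm (w k))\<^sup>2) = ?d" .
    \<comment> \<open>This \<theta> is close to the minimiser \<epsilon> / (4 M') of the leading
      quadratic; the smaller value compensates for the denominator 1 - M' \<theta> / 2 = 1 -
      \<epsilon> / 10.\<close>
    show "0 \<le> \<epsilon> / (5 * M')" "M' * (\<epsilon> / (5 * M')) < 2" using M'0 eps by auto
    have "a \<le> \<epsilon>\<^sup>2 * ?m * q / 2"
    proof -
      have "a * 1 \<le> (\<epsilon>\<^sup>2 * ?m / 2) * q" using m a q by (intro mult_mono) auto
      then show ?thesis by simp
    qed
    \<comment> \<open>The 36 is what the exponents leave for a: \<theta> r = \<epsilon>^2 / (20 M'),
      the quadratic term is at most \<epsilon>^2 / (45 M'), and 1 / 20 - 1 / 45 = 1 / 36.\<close>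
    then have *: "a \<le> \<epsilon>\<^sup>2 / (36 * M')" using m1 q by (simp add: M'_def mult_ac)
    have "M' * (\<epsilon> / (5 * M'))\<^sup>2 / (2 * (1 - M' / 2 * (\<epsilon> / (5 * M')))) = (\<epsilon>\<^sup>2 / M') * (1 / (50 * (1 - \<epsilon> / 10)))"
      using M'0 eps by (simp add: power2_eq_square field_simps)
    also have "\<dots> \<le> (\<epsilon>\<^sup>2 / M') * (1 / 45)"
      using M'0 eps by (intro mult_left_mono divide_left_mono) auto
    finally show "M' * (\<epsilon> / (5 * M'))\<^sup>2 / (2 * (1 - M' / 2 * (\<epsilon> / (5 * M')))) + a \<le> \<epsilon> / (5 * M') * (\<epsilon> / 4)"
      using * by (simp add: power2_eq_square)
  qed simp
  have "exp 1 * (10 / 9) / ?m \<le> 10 / (3 * ?m)"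
    using exp_le m1 by (simp add: field_simps)
  then have mono: "exp 1 * (10 / 9) / ?m * (norm v)\<^sup>2 \<le> 10 / (3 * ?m) * (norm v)\<^sup>2" for v :: "real ^ 'm"
    by (intro mult_right_mono) auto
  have "{p\<in>?P. \<not> ((\<forall>v. v \<bullet> (sampled_matrix u w p *v v) \<le> 10 / (3 * ?m) * (norm v)\<^sup>2)
      \<and> \<bar>(\<Sum>k\<in>UNIV. u (p k) * (norm (w k))\<^sup>2) - 1\<bar> < \<epsilon> / 4)} \<subseteq> BX \<union> BT" (is "?A \<subseteq> _")
    unfolding BX_def BT_def using mono order_trans by (smt (verit) Un_iff mem_Collect_eq subsetI)
  then have "card ?A \<le> card (BX \<union> BT)"
    by (intro card_mono) (auto simp: BX_def BT_def finite_permutes_UNIV)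
  also have "\<dots> \<le> card BX + card BT" by (rule card_Un_le)
  finally have "real (card ?A) \<le> real (card BX) + real (card BT)" by linarith
  also have "\<dots> \<le> real (card ?P) * exp (- a) + 2 * real (card ?P) * exp (- a)"
    using BX BT by (rule add_mono)
  also have "\<dots> = 3 * exp (- a) * real (card ?P)" by simp
  finally show ?thesis .
qed

text \<open>The quadratic form concentrates around the trace \<tau>, not around 1. Half of the
  allowed \<epsilon> / 2 covers the distance from \<tau> to 1, the other half the fluctuation in
  \<xi>.\<close>

lemma sign_tail:
  fixes R :: "real ^ 'd ^ 'm::finite"
  assumes L: "\<And>v. (norm (transpose R *v v))\<^sup>2 \<le> 10 / (3 * real CARD('m)) * (norm v)\<^sup>2"
    and M: "\<And>k. (norm (column k R))\<^sup>2 \<le> 1 / (18 * real CARD('m))"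
    and tr: "\<bar>(\<Sum>k\<in>UNIV. (norm (column k R))\<^sup>2) - 1\<bar> < \<epsilon> / 4"
    and eps: "0 < \<epsilon>" "\<epsilon> < 1" and m: "2025 * a \<le> \<epsilon>\<^sup>2 * real CARD('m)"
  shows "real (card {\<xi>\<in>sign_vectors. \<epsilon> / 2 < \<bar>(norm (R *v \<xi>))\<^sup>2 - 1\<bar>})
    \<le> 2 * exp (- a) * real (card (sign_vectors :: (real ^ 'd) set))"
proof -
  let ?m = "real CARD('m)" and ?S = "sign_vectors :: (real ^ 'd) set"
  define \<tau> where "\<tau> = (\<Sum>k\<in>UNIV. (norm (column k R))\<^sup>2)"
  have m1: "1 \<le> ?m" by (simp add: Suc_le_eq card_gt_0_iff)
  have "real (card {\<xi>\<in>?S. \<epsilon> / 4 \<le> \<bar>(norm (R *v \<xi>))\<^sup>2 - \<tau>\<bar>}) \<le> 2 * real (card ?S) * exp (- a)"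
  proof (rule rademacher_quadratic_tail[OF L M \<tau>_def[symmetric], where \<theta> = "?m * \<epsilon> / 80"])
    \<comment> \<open>With \<theta> = m \<epsilon> / 80 the gain \<theta> r is \<epsilon>^2 m / 320.
      Since L + M = 61 / (18 m), \<tau> \<le> 5 / 4 and 2 (1 - \<epsilon> / 6) \<ge> 5 / 3, the loss
      is at most 61 / 38400 times \<epsilon>^2 m. The difference, 59 / 38400 times \<epsilon>^2 m,
      dominates a by the lower bound on m.\<close>
    have e4: "4 * (10 / (3 * ?m)) * (?m * \<epsilon> / 80) = \<epsilon> / 6" using m1 by simp
    then show "4 * (10 / (3 * ?m)) * (?m * \<epsilon> / 80) < 1" using eps by simp
    have "4 * (10 / (3 * ?m) + 1 / (18 * ?m)) * \<tau> * (?m * \<epsilon> / 80)\<^sup>2 / (2 * (1 - \<epsilon> / 6))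
      = (\<epsilon>\<^sup>2 * ?m) * ((61 / 28800) * \<tau> / (2 * (1 - \<epsilon> / 6)))"
      using m1 eps by (simp add: power2_eq_square field_simps)
    also have "\<dots> \<le> (\<epsilon>\<^sup>2 * ?m) * ((61 / 28800) * (5 / 4) / (5 / 3))"
    proof (intro mult_left_mono frac_le)
      show "\<tau> \<le> 5 / 4" using tr eps unfolding \<tau>_def[symmetric] by linarith
    qed (use eps m1 in auto)
    finally have "4 * (10 / (3 * ?m) + 1 / (18 * ?m)) * \<tau> * (?m * \<epsilon> / 80)\<^sup>2 / (2 * (1 - \<epsilon> / 6))
      \<le> (\<epsilon>\<^sup>2 * ?m) * ((61 / 28800) * (5 / 4) / (5 / 3))" .
    moreover have "(\<epsilon>\<^sup>2 * ?m) * ((61 / 28800) * (5 / 4) / (5 / 3)) + a \<le> ?m * \<epsilon> / 80 * (\<epsilon> / 4)"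
    proof -
      define t where "t = \<epsilon>\<^sup>2 * ?m"
      have eq: "?m * \<epsilon> / 80 * (\<epsilon> / 4) = t / 320" by (simp add: t_def power2_eq_square)
      have "0 \<le> t" "2025 * a \<le> t" using m by (simp_all add: t_def)
      then show ?thesis unfolding eq t_def[symmetric] by (simp add: field_simps)
    qed
    ultimately show "4 * (10 / (3 * ?m) + 1 / (18 * ?m)) * \<tau> * (?m * \<epsilon> / 80)\<^sup>2 / (2 * (1 - 4 * (10 / (3 * ?m)) * (?m * \<epsilon> / 80))) + a
      \<le> ?m * \<epsilon> / 80 * (\<epsilon> / 4)"
      unfolding e4 by linarith
  qed (use m1 eps in auto)
  moreover have "real (card {\<xi>\<in>?S. \<epsilon> / 2 < \<bar>(norm (R *v \<xi>))\<^sup>2 - 1\<bar>}) \<le> real (card {\<xi>\<in>?S. \<epsilon> / 4 \<le> \<bar>(norm (R *v \<xi>))\<^sup>2 - \<tau>\<bar>})"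
  proof -
    have "\<epsilon> / 4 \<le> \<bar>t - \<tau>\<bar>" if "\<epsilon> / 2 < \<bar>t - 1\<bar>" for t
      using tr that unfolding \<tau>_def[symmetric] by linarith
    then show ?thesis by (intro of_nat_mono card_mono) (auto simp: finite_sign_vectors)
  qed
  ultimately have "real (card {\<xi>\<in>?S. \<epsilon> / 2 < \<bar>(norm (R *v \<xi>))\<^sup>2 - 1\<bar>}) \<le> 2 * real (card ?S) * exp (- a)"
    by (rule order_trans[rotated])
  then show ?thesis by (simp only: mult_ac)
qed

section \<open>The random map applied to a fixed unit vector\<close>

lemma norm_orthogonal_matrix_mult: "orthogonal_matrix B \<Longrightarrow> norm (B *v x) = norm x" for x :: "real ^ 'd"
  using orthogonal_transformation_matrix[of "(*v) B"] by (simp add: orthogonal_transformation)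

lemma norm_diag_sign_mult:
  fixes x :: "real ^ 'd"
  assumes "\<xi> \<in> sign_vectors"
  shows "norm (diag_matrix \<xi> *v x) = norm x"
  by (simp add: norm_eq inner_vec_def diag_matrix_mult_vec power2_eq_square[symmetric] power_mult_distrib
      sign_vectors_square[OF assms])

lemma Phi_mult:
  "(Phi e A B \<xi> \<xi>' p *v x) $ i = (\<Sum>k\<in>UNIV. (B *v (diag_matrix \<xi>' *v x)) $ p k
     * (sqrt (real CARD('d) / real CARD('m)) * A $ e i $ k) * \<xi> $ k)"
  for A B :: "real ^ 'd ^ 'd" and e :: "'m::finite \<Rightarrow> 'd"
proof -
  define y where "y = B *v (diag_matrix \<xi>' *v x)"
  have "Phi e A B \<xi> \<xi>' p *v x = sqrt (real CARD('d) / real CARD('m)) *\<^sub>R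
    (coord_matrix e *v (A *v (diag_matrix \<xi> *v (coord_matrix p *v y))))"
    unfolding Phi_def y_def by (simp add: scaleR_matrix_vector_assoc matrix_vector_mul_assoc matrix_mul_assoc)
  then show ?thesis
    unfolding y_def[symmetric]
    by (simp add: coord_matrix_mult_vec matrix_vector_mult_def[of A] diag_matrix_mult_vec sum_distrib_left mult_ac)
qed

text \<open>The three sources of randomness are used in a fixed order: \<xi>' makes the weights
  \<open>u\<close> flat, \<pi> then makes the sampled matrix well conditioned, and given both only
  \<xi> remains random. Their failure probabilities 2, 3 and 2 times exp (- a) add up to the
  7.\<close>

lemma single_vector_bound:
  fixes A B :: "real ^ 'd ^ 'd" and e :: "'m::finite \<Rightarrow> 'd" and x :: "real ^ 'd"
  assumes A: "orthogonal_matrix A" and B: "orthogonal_matrix B" and e: "bij_betw e UNIV I"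
    and x: "norm x = 1"
    and K: "\<And>k. (\<Sum>j\<in>I. (A $ j $ k)\<^sup>2) \<le> K * real CARD('m) / real CARD('d)"
    and v: "\<And>k. (\<Sum>j\<in>UNIV. (B $ k $ j)\<^sup>2 * (x $ j)\<^sup>2) \<le> T / real CARD('d)" and T0: "0 < T"
    and a: "1 \<le> a" and eps: "0 < \<epsilon>" "\<epsilon> < 1" and m: "2025 * a \<le> \<epsilon>\<^sup>2 * real CARD('m)"
    and bound: "36 * K * T * real CARD('m) * (a + ln (real CARD('d))) * (a + ln (real CARD('m))) \<le> real CARD('d)"
  shows "measure_pmf.prob sign_perm_pmf
    {(\<xi>, \<xi>', p). \<epsilon> / 2 < \<bar>(norm (Phi e A B \<xi> \<xi>' p *v x))\<^sup>2 - 1\<bar>} \<le> 7 * exp (- a)"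
proof -
  let ?S = "sign_vectors :: (real ^ 'd) set" and ?P = "perms :: ('d \<Rightarrow> 'd) set"
  let ?d = "real CARD('d)" and ?m = "real CARD('m)"
  have d1: "1 \<le> ?d" and m1: "1 \<le> ?m" by (simp_all add: Suc_le_eq card_gt_0_iff)
  define q where "q = a + ln ?m"
  have q: "1 \<le> q" unfolding q_def using a ln_ge_zero[OF m1] by linarith
  define \<mu> where "\<mu> = 2 * (T / ?d) * (a + ln ?d)"
  define y where "y \<xi>' = B *v (diag_matrix \<xi>' *v x)" for \<xi>'
  define u where "u \<xi>' k = (y \<xi>' $ k)\<^sup>2" for \<xi>' k
  define w where "w k = (\<chi> i. sqrt (?d / ?m) * A $ e i $ k)" for k :: 'd
  define good1 where "good1 \<xi>' \<longleftrightarrow> (\<forall>k. u \<xi>' k \<le> \<mu>)" for \<xi>'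
  define good2 where "good2 \<xi>' p \<longleftrightarrow> (\<forall>v. v \<bullet> (sampled_matrix (u \<xi>') w p *v v) \<le> 10 / (3 * ?m) * (norm v)\<^sup>2)
      \<and> \<bar>(\<Sum>k\<in>UNIV. u \<xi>' (p k) * (norm (w k))\<^sup>2) - 1\<bar> < \<epsilon> / 4" for \<xi>' p
  define bad where "bad \<xi> \<xi>' p \<longleftrightarrow> \<epsilon> / 2 < \<bar>(norm (Phi e A B \<xi> \<xi>' p *v x))\<^sup>2 - 1\<bar>" for \<xi> \<xi>' p
  have w1: "(norm (w k))\<^sup>2 \<le> K" for k
  proof -
    have "(norm (w k))\<^sup>2 = (\<Sum>i\<in>UNIV. (?d / ?m) * (A $ e i $ k)\<^sup>2)"
      unfolding power2_norm_eq_inner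
      by (simp add: inner_vec_def w_def power_mult_distrib flip: power2_eq_square)
    also have "\<dots> = (?d / ?m) * (\<Sum>j\<in>I. (A $ j $ k)\<^sup>2)"
      unfolding sum_distrib_left[symmetric] by (simp add: sum.reindex_bij_betw[OF e, of "\<lambda>j. (A $ j $ k)\<^sup>2"])
    also have "\<dots> \<le> (?d / ?m) * (K * ?m / ?d)" by (intro mult_left_mono K) auto
    also have "\<dots> = K" using d1 m1 by simp
    finally show ?thesis .
  qed
  \<comment> \<open>The rows of \<open>A\<close> are orthonormal and \<open>e\<close> is injective,
    so the selected and rescaled columns form a tight frame of the m-dimensional space.\<close>
  have wsum: "(\<Sum>k\<in>UNIV. outer (w k)) = (?d / ?m) *\<^sub>R mat 1"
  proof -
    have "A ** transpose A = mat 1" using A by (simp add: orthogonal_matrix_def)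
    then have "(\<Sum>k\<in>UNIV. A $ i $ k * A $ j $ k) = (if i = j then 1 else 0)" for i j
      by (simp add: vec_eq_iff matrix_matrix_mult_def transpose_def mat_def)
    moreover have "e i = e j \<longleftrightarrow> i = j" for i j using e by (auto simp: bij_betw_def inj_on_def)
    moreover have "(sqrt (?d / ?m) * s) * (sqrt (?d / ?m) * t) = (?d / ?m) * (s * t)" for s t
    proof -
      have "(sqrt (?d / ?m) * s) * (sqrt (?d / ?m) * t) = (sqrt (?d / ?m) * sqrt (?d / ?m)) * (s * t)"
        by (simp only: mult_ac)
      also have "sqrt (?d / ?m) * sqrt (?d / ?m) = ?d / ?m" by (subst real_sqrt_mult_self) simp
      finally show ?thesis .
    qed
    ultimately have "(\<Sum>k\<in>UNIV. outer (w k)) $ i $ j = (?d / ?m) * (if i = j then 1 else 0)" for i j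
      by (simp only: sum_component outer_def w_def vec_lambda_beta sum_distrib_left[symmetric])
    then show ?thesis by (simp add: vec_eq_iff mat_def)
  qed
  have usum: "(\<Sum>k\<in>UNIV. u \<xi>' k) = 1" if "\<xi>' \<in> ?S" for \<xi>'
  proof -
    have "(\<Sum>k\<in>UNIV. u \<xi>' k) = (norm (y \<xi>'))\<^sup>2"
      unfolding power2_norm_eq_inner by (simp add: inner_vec_def u_def power2_eq_square)
    also have "norm (y \<xi>') = 1"
      unfolding y_def norm_orthogonal_matrix_mult[OF B] norm_diag_sign_mult[OF that] by (rule x)
    finally show ?thesis by simp
  qed
  \<comment> \<open>Here the 36 splits: the factor 2 sits in \<mu>, the threshold of
    \<open>coordinate_tail\<close> with v = T / d, and 18 is left for the sampling step.\<close>
  have M: "K * \<mu> \<le> 1 / (18 * ?m * q)"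
  proof -
    have "36 * K * T * ?m * (a + ln ?d) * q = (K * \<mu>) * (18 * ?m * q) * ?d"
      using d1 by (simp add: \<mu>_def)
    moreover have "36 * K * T * ?m * (a + ln ?d) * q \<le> ?d" using bound unfolding q_def .
    ultimately have "(K * \<mu>) * (18 * ?m * q) * ?d \<le> 1 * ?d" by linarith
    then have "(K * \<mu>) * (18 * ?m * q) \<le> 1" using d1 by (simp only: mult_le_cancel_right_pos)
    then show ?thesis using m1 q by (simp add: pos_le_divide_eq)
  qed
  have P1: "measure_pmf.prob (pmf_of_set ?S) {\<xi>'. \<not> good1 \<xi>'} \<le> 2 * exp (- a)"
  proof (rule prob_pmf_of_set_le[OF finite_sign_vectors sign_vectors_nonempty])
    show "real (card {\<xi>'\<in>?S. \<not> good1 \<xi>'}) \<le> 2 * exp (- a) * real (card ?S)"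
      using coordinate_tail[OF v, of a] T0 d1 a by (simp add: good1_def not_le u_def y_def \<mu>_def)
  qed
  have P2: "measure_pmf.prob (pmf_of_set ?P) {p. good1 \<xi>' \<and> \<not> good2 \<xi>' p} \<le> 3 * exp (- a)" if \<xi>': "\<xi>' \<in> ?S" for \<xi>'
  proof (cases "good1 \<xi>'")
    case True
    have "real (card {p\<in>?P. \<not> good2 \<xi>' p}) \<le> 3 * exp (- a) * real (card ?P)"
      unfolding good2_def
    proof (rule sampling_tail[where \<mu> = \<mu> and \<kappa> = K])
      show "0 \<le> u \<xi>' k" for k by (simp add: u_def)
      show "u \<xi>' k \<le> \<mu>" for k using True by (simp add: good1_def)
    qed (use usum[OF \<xi>'] w1 wsum M a eps m in \<open>auto simp: q_def\<close>)
    then show ?thesis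
      using True by (simp add: prob_pmf_of_set_le[OF finite_permutes_UNIV permutes_UNIV_nonempty])
  qed simp
  have P3: "measure_pmf.prob (pmf_of_set ?S) {\<xi>. good1 \<xi>' \<and> good2 \<xi>' p \<and> bad \<xi> \<xi>' p} \<le> 2 * exp (- a)" for \<xi>' p
  proof (cases "good1 \<xi>' \<and> good2 \<xi>' p")
    case True
    define R where "R = (\<chi> i k. y \<xi>' $ p k * w k $ i)"
    have Phi: "Phi e A B \<xi> \<xi>' p *v x = R *v \<xi>" for \<xi>
      unfolding vec_eq_iff Phi_mult by (simp add: R_def w_def y_def matrix_vector_mult_def)
    have RR: "R ** transpose R = sampled_matrix (u \<xi>') w p"
      by (simp add: vec_eq_iff R_def sampled_matrix_def matrix_matrix_mult_def transpose_def outer_def u_def power2_eq_square mult_ac)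
    have col: "(norm (column k R))\<^sup>2 = u \<xi>' (p k) * (norm (w k))\<^sup>2" for k
    proof -
      have "column k R = (y \<xi>' $ p k) *\<^sub>R w k" by (simp add: column_def R_def vec_eq_iff)
      then show ?thesis by (simp add: u_def power_mult_distrib)
    qed
    have "real (card {\<xi>\<in>?S. \<epsilon> / 2 < \<bar>(norm (R *v \<xi>))\<^sup>2 - 1\<bar>}) \<le> 2 * exp (- a) * real (card ?S)"
    proof (rule sign_tail)
      show "(norm (transpose R *v v))\<^sup>2 \<le> 10 / (3 * ?m) * (norm v)\<^sup>2" for v
        using True unfolding gram_quadratic[symmetric] RR by (simp add: good2_def)
      show "(norm (column k R))\<^sup>2 \<le> 1 / (18 * ?m)" for k
      proof -
        have "(norm (column k R))\<^sup>2 \<le> \<mu> * K"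
          unfolding col using True w1 by (intro mult_mono) (auto simp: good1_def u_def intro: order_trans[OF zero_le_power2])
        also have "\<dots> \<le> 1 / (18 * ?m * q)" using M by (simp add: mult.commute)
        also have "\<dots> \<le> 1 / (18 * ?m)" using m1 q by (intro divide_left_mono) auto
        finally show ?thesis .
      qed
      show "\<bar>(\<Sum>k\<in>UNIV. (norm (column k R))\<^sup>2) - 1\<bar> < \<epsilon> / 4"
        unfolding col using True by (simp add: good2_def)
    qed (use eps m in auto)
    then show ?thesis
      using True by (simp add: bad_def Phi prob_pmf_of_set_le[OF finite_sign_vectors sign_vectors_nonempty])
  qed auto
  let ?prob = "measure_pmf.prob (sign_perm_pmf :: ((real ^ 'd) \<times> (real ^ 'd) \<times> ('d \<Rightarrow> 'd)) pmf)"
  \<comment> \<open>Each event includes the success of the previous stages, so that its conditional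
    probability is bounded for every revealed value; where an earlier stage fails, the event is
    empty.\<close>
  have "?prob {(\<xi>, \<xi>', p). bad \<xi> \<xi>' p} \<le> ?prob (({(\<xi>, \<xi>', p). \<not> good1 \<xi>'} \<union> {(\<xi>, \<xi>', p). good1 \<xi>' \<and> \<not> good2 \<xi>' p})
      \<union> {(\<xi>, \<xi>', p). good1 \<xi>' \<and> good2 \<xi>' p \<and> bad \<xi> \<xi>' p})"
    by (intro measure_pmf.finite_measure_mono) auto
  also have "\<dots> \<le> ?prob {(\<xi>, \<xi>', p). \<not> good1 \<xi>'} + ?prob {(\<xi>, \<xi>', p). good1 \<xi>' \<and> \<not> good2 \<xi>' p}
      + ?prob {(\<xi>, \<xi>', p). good1 \<xi>' \<and> good2 \<xi>' p \<and> bad \<xi> \<xi>' p}"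
    by (intro order_trans[OF measure_Un_le] add_right_mono) auto
  also have "\<dots> \<le> 2 * exp (- a) + 3 * exp (- a) + 2 * exp (- a)"
  proof (intro add_mono)
    show "?prob {(\<xi>, \<xi>', p). \<not> good1 \<xi>'} \<le> 2 * exp (- a)"
      unfolding sign_perm_pmf_def by (intro prob_pair_pmf_le_snd prob_pair_pmf_le_fst P1) auto
    show "?prob {(\<xi>, \<xi>', p). good1 \<xi>' \<and> \<not> good2 \<xi>' p} \<le> 3 * exp (- a)"
      unfolding sign_perm_pmf_def
      by (intro prob_pair_pmf_le_snd P2) (auto simp: finite_sign_vectors sign_vectors_nonempty)
    have "measure_pmf.prob (pmf_of_set ?S) {\<xi>. case z of (\<xi>', p) \<Rightarrow> good1 \<xi>' \<and> good2 \<xi>' p \<and> bad \<xi> \<xi>' p} \<le> 2 * exp (- a)" for z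
      using P3 by (cases z) simp
    then show "?prob {(\<xi>, \<xi>', p). good1 \<xi>' \<and> good2 \<xi>' p \<and> bad \<xi> \<xi>' p} \<le> 2 * exp (- a)"
      unfolding sign_perm_pmf_def by (rule prob_pair_pmf_le_fst) simp
  qed
  finally show ?thesis by (simp add: bad_def)
qed

subsection \<open>Union bound\<close>

theorem proposition5p7:
  fixes E :: "nat \<Rightarrow> (real ^ 'd::finite) set"
    and s m :: nat
    and \<epsilon> \<eta> a :: real
    and A B :: "real ^ 'd ^ 'd"
    and I :: "'d set"
    and e :: "'m::finite \<Rightarrow> 'd"
    and EE S :: "(real ^ 'd) set"
  assumes subspaces: "\<And>j. j \<in> {1..s} \<Longrightarrow> subspace (E j)"
    and EE_def: "EE = (\<Union>j\<in>{1..s}. E j)"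
    and S_def: "S = EE \<inter> sphere 0 1"
    and eps: "0 < \<epsilon>" "\<epsilon> < 1"
    and eta: "0 < \<eta>" "\<eta> < 1 / 2"
    and a_def: "a = ln (8 / \<eta> * (\<Sum>j=1..s. 9 ^ dim (E j)))"
    and A: "orthogonal_matrix A"
    and B: "orthogonal_matrix B"
    and I_card: "card I = m"
    and e: "bij_betw e UNIV I"
    and m_ge: "real m \<ge> 2025 / \<epsilon>\<^sup>2 * a"
    and bound: "36 * kappa I A * Theta B S * real m
        * (a + ln (real CARD('d))) * (a + ln (real m)) \<le> real CARD('d)"
  shows "measure_pmf.prob sign_perm_pmf
      {(\<xi>, \<xi>', \<pi>). \<forall>x\<in>EE.
         \<bar>(norm (Phi e A B \<xi> \<xi>' \<pi> *v x))\<^sup>2 - (norm x)\<^sup>2\<bar> \<le> \<epsilon> * (norm x)\<^sup>2} \<ge> 1 - \<eta>"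
    (is "_ \<le> measure_pmf.prob _ ?good")
proof -
  let ?d = "real CARD('d)" and ?m = "real CARD('m)"
  let ?prob = "measure_pmf.prob (sign_perm_pmf :: ((real ^ 'd) \<times> (real ^ 'd) \<times> ('d \<Rightarrow> 'd)) pmf)"
  have mm: "m = CARD('m)" using bij_betw_same_card[OF e] I_card by simp
  have d1: "1 \<le> ?d" and m1: "1 \<le> ?m" by (simp_all add: Suc_le_eq card_gt_0_iff)
  define \<Lambda> where "\<Lambda> = (\<Sum>j=1..s. 9 ^ dim (E j) :: real)"
  have "\<exists>N. finite N \<and> N \<subseteq> E j \<inter> sphere 0 1 \<and> card N \<le> 9 ^ dim (E j)
      \<and> (\<forall>x\<in>E j \<inter> sphere 0 1. \<exists>y\<in>N. dist x y \<le> 1 / 4)" if "j \<in> {1..s}" for j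
    using subspace_sphere_net[OF subspaces[OF that]] by metis
  then obtain N where N: "\<And>j. j \<in> {1..s} \<Longrightarrow> finite (N j) \<and> N j \<subseteq> E j \<inter> sphere 0 1 \<and> card (N j) \<le> 9 ^ dim (E j)
      \<and> (\<forall>x\<in>E j \<inter> sphere 0 1. \<exists>y\<in>N j. dist x y \<le> 1 / 4)"
    by metis
  define NN where "NN = (\<Union>j\<in>{1..s}. N j)"
  define bad where "bad x = {(\<xi>, \<xi>', \<pi>). \<epsilon> / 2 < \<bar>(norm (Phi e A B \<xi> \<xi>' \<pi> *v x))\<^sup>2 - 1\<bar>}" for x
  have finNN: "finite NN" using N by (auto simp: NN_def)
  have NN_S: "NN \<subseteq> S" using N by (force simp: NN_def S_def EE_def)
  have cardNN: "real (card NN) \<le> \<Lambda>"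
  proof -
    have "card NN \<le> (\<Sum>j=1..s. card (N j))" unfolding NN_def by (rule card_UN_le) simp
    also have "\<dots> \<le> (\<Sum>j=1..s. 9 ^ dim (E j))" using N by (intro sum_mono) blast
    finally have "real (card NN) \<le> real (\<Sum>j=1..s. 9 ^ dim (E j))" by (rule of_nat_mono)
    then show ?thesis by (simp add: \<Lambda>_def)
  qed
  \<comment> \<open>The argument starts from a point of the net because its existence supplies what
    is needed: the supremum in \<open>Theta\<close> is over a nonempty set, and \<Lambda> \<ge> 1,
    whence a \<ge> 1. If the net is empty, the union bound below is an empty sum.\<close>
  have single: "?prob (bad x) \<le> 7 * exp (- a)" if xN: "x \<in> NN" for x
  proof -
    have xS: "x \<in> S" using xN NN_S by auto
    then have x1: "norm x = 1" by (simp add: S_def)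
    have \<Lambda>1: "1 \<le> \<Lambda>"
    proof -
      from xN have "1 \<le> card NN" using finNN by (metis One_nat_def Suc_leI card_gt_0_iff empty_iff)
      then show ?thesis using cardNN by linarith
    qed
    have a1: "1 \<le> a"
    proof -
      have "exp 1 * \<eta> \<le> 3 * 1" using eta exp_le by (intro mult_mono) auto
      then have "exp 1 \<le> 8 / \<eta>" using eta by (simp add: pos_le_divide_eq)
      also have "8 / \<eta> \<le> 8 / \<eta> * \<Lambda>" using mult_left_mono[OF \<Lambda>1, of "8 / \<eta>"] eta by simp
      finally have "ln (exp 1) \<le> ln (8 / \<eta> * \<Lambda>)" by (intro ln_mono) auto
      then show ?thesis by (simp add: a_def \<Lambda>_def)
    qed
    \<comment> \<open>The squared Frobenius norm of \<open>B\<close> is a crude bound, enough to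
      make the supremum in \<open>Theta\<close> an upper bound.\<close>
    have bdd: "bdd_above ((\<lambda>(x, k). \<Sum>j\<in>UNIV. (B $ k $ j)\<^sup>2 * (x $ j)\<^sup>2) ` (S \<times> UNIV))"
    proof (rule bdd_aboveI2)
      fix z assume "z \<in> S \<times> (UNIV :: 'd set)"
      then obtain x k where z: "z = (x, k)" and x: "norm x = 1" by (auto simp: S_def)
      have "(\<Sum>j\<in>UNIV. (B $ k $ j)\<^sup>2 * (x $ j)\<^sup>2) \<le> (\<Sum>j\<in>UNIV. (B $ k $ j)\<^sup>2 * 1)"
        using component_le_norm_cart[of x] x by (intro sum_mono mult_left_mono) (simp_all add: abs_square_le_1)
      then show "(case z of (x, k) \<Rightarrow> \<Sum>j\<in>UNIV. (B $ k $ j)\<^sup>2 * (x $ j)\<^sup>2) \<le> (\<Sum>k\<in>UNIV. \<Sum>j\<in>UNIV. (B $ k $ j)\<^sup>2)"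
        using member_le_sum[of k UNIV "\<lambda>k. \<Sum>j\<in>UNIV. (B $ k $ j)\<^sup>2"] by (simp add: z sum_nonneg)
    qed
    have v: "(\<Sum>j\<in>UNIV. (B $ k $ j)\<^sup>2 * (x $ j)\<^sup>2) \<le> Theta B S / ?d" for k
      using cSUP_upper[OF _ bdd, of "(x, k)"] xS d1 by (simp add: Theta_def)
    have K: "(\<Sum>j\<in>I. (A $ j $ k)\<^sup>2) \<le> kappa I A * ?m / ?d" for k
      using Max_ge[of "range (\<lambda>k. \<Sum>j\<in>I. (A $ j $ k)\<^sup>2)" "\<Sum>j\<in>I. (A $ j $ k)\<^sup>2"] d1 m1
      by (simp add: kappa_def I_card mm)
    \<comment> \<open>Averaging: the d row sums bounded by \<open>Theta B S / d\<close> add up to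
      |x|^2 = 1 because the columns of \<open>B\<close> have norm 1. Hence \<open>Theta B S\<close>
      is even at least 1; positivity is what the Hoeffding variance requires.\<close>
    have T0: "0 < Theta B S"
    proof -
      have "transpose B ** B = mat 1" using B by (simp add: orthogonal_matrix)
      then have cols: "(\<Sum>k\<in>UNIV. (B $ k $ j)\<^sup>2) = 1" for j
        by (simp add: vec_eq_iff matrix_matrix_mult_def transpose_def mat_def power2_eq_square)
      have "1 = (\<Sum>j\<in>UNIV. (\<Sum>k\<in>UNIV. (B $ k $ j)\<^sup>2) * (x $ j)\<^sup>2)"
        unfolding cols using x1 by (simp add: norm_eq_1 inner_vec_def power2_eq_square)
      also have "\<dots> = (\<Sum>k\<in>UNIV. \<Sum>j\<in>UNIV. (B $ k $ j)\<^sup>2 * (x $ j)\<^sup>2)"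
        by (subst sum.swap) (simp add: sum_distrib_right)
      also have "\<dots> \<le> (\<Sum>k\<in>(UNIV :: 'd set). Theta B S / ?d)" by (intro sum_mono v)
      also have "\<dots> = Theta B S" using d1 by simp
      finally show ?thesis by simp
    qed
    have "2025 * a \<le> \<epsilon>\<^sup>2 * ?m" using m_ge eps by (simp add: mm field_simps)
    from single_vector_bound[OF A B e x1 K v T0 a1 eps this] bound
    show ?thesis by (simp add: bad_def mm)
  qed
  have "- ?good \<subseteq> (\<Union>x\<in>NN. bad x)"
  proof
    fix z assume "z \<in> - ?good"
    obtain \<xi> \<xi>' \<pi> where z: "z = (\<xi>, \<xi>', \<pi>)" by (cases z)
    show "z \<in> (\<Union>x\<in>NN. bad x)"
    proof (rule ccontr)
      assume "z \<notin> (\<Union>x\<in>NN. bad x)"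
      then have small: "\<bar>(norm (Phi e A B \<xi> \<xi>' \<pi> *v y))\<^sup>2 - 1\<bar> \<le> \<epsilon> / 2" if "y \<in> NN" for y
        using that by (auto simp: bad_def z not_less)
      have "\<bar>(norm (Phi e A B \<xi> \<xi>' \<pi> *v x))\<^sup>2 - (norm x)\<^sup>2\<bar> \<le> \<epsilon> * (norm x)\<^sup>2" if "x \<in> EE" for x
      proof -
        from that obtain j where j: "j \<in> {1..s}" "x \<in> E j" by (auto simp: EE_def)
        show ?thesis
        proof (rule net_extension[OF subspaces[OF j(1)], of "N j"])
          show "\<bar>(norm (Phi e A B \<xi> \<xi>' \<pi> *v y))\<^sup>2 - 1\<bar> \<le> \<epsilon> / 2" if "y \<in> N j" for y
            using that j(1) by (intro small) (auto simp: NN_def)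
        qed (use N[OF j(1)] j(2) in auto)
      qed
      with \<open>z \<in> - ?good\<close> show False by (simp add: z)
    qed
  qed
  then have "?prob (- ?good) \<le> ?prob (\<Union>x\<in>NN. bad x)" by (intro measure_pmf.finite_measure_mono) auto
  also have "\<dots> \<le> (\<Sum>x\<in>NN. ?prob (bad x))"
    by (rule measure_pmf.finite_measure_subadditive_finite[OF finNN]) auto
  also have "\<dots> \<le> (\<Sum>x\<in>NN. 7 * exp (- a))" by (intro sum_mono single)
  also have "\<dots> \<le> \<eta>"
  proof (cases "NN = {}")
    case True
    then show ?thesis using eta by simp
  next
    case False
    then have "0 < real (card NN)" using finNN by (simp add: card_gt_0_iff)
    then have \<Lambda>0: "0 < \<Lambda>" using cardNN by linarith
    \<comment> \<open>This is where the definition of a is spent: at most \<Lambda> net points, each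
      failing with probability at most 7 \<eta> / (8 \<Lambda>), give 7 \<eta> / 8 in total.\<close>
    have ea: "exp (- a) = \<eta> / (8 * \<Lambda>)"
      using \<Lambda>0 eta unfolding a_def \<Lambda>_def[symmetric] by (simp add: exp_minus)
    have "(\<Sum>x\<in>NN. 7 * exp (- a)) = real (card NN) * (7 * exp (- a))" by simp
    also have "\<dots> \<le> \<Lambda> * (7 * exp (- a))" using cardNN by (intro mult_right_mono) auto
    also have "\<dots> \<le> \<eta>" using \<Lambda>0 eta by (simp add: ea)
    finally show ?thesis .
  qed
  finally have "?prob (- ?good) \<le> \<eta>" .
  then show ?thesis using measure_pmf.prob_compl[of ?good sign_perm_pmf] by (simp add: Compl_eq_Diff_UNIV)
qed

end
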